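(* Let $d\ge1$ be an integer, $\tau>0$, $s\in\mathbb{R}$, $h\ge\tau$, and $C\in L^{\infty}([s,s+h]\times[-\tau,0],\mathbb{R}^{d\times d})$. Consider, for $\phi\in X=L^2([-\tau,0],\mathbb{R}^d)$, the initial value problem $$x(t)=\int_{-\tau}^0C(t,\theta)\,x(t+\theta)\,d\theta,\quad t>s,\qquad x(s+\theta)=\phi(\theta),\ \theta\in[-\tau,0].$$ The associated evolution operator $T(s+h,s)\colon X\to X$ is compact.
   Context: $X=L^2([-\tau,0],\mathbb{R}^d)$ has the usual $L^2$ norm. For $\phi\in X$ the initial value problem has a unique solution $x=x(\cdot;s,\phi)$ on $[s-\tau,s+h]$, square-integrable, with the equation holding for almost every $t\in[s,s+h]$. The evolution operator is $T(t,s)\phi=x_t(\cdot;s,\phi)$, where $x_t(\theta)=x(t+\theta)$ for $\theta\in[-\tau,0]$; in particular $(T(s+h,s)\phi)(\theta)=x(s+h+\theta;s,\phi)$. *)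

theory Defs
  imports "HOL-Analysis.Analysis"
begin

section \<open>The space $L^2$ of a measure\<close>

definition L2_fun :: "'a measure \<Rightarrow> ('a \<Rightarrow> 'b::euclidean_space) set" where
  "L2_fun M = {f \<in> borel_measurable M. integrable M (\<lambda>x. (norm (f x))\<^sup>2)}"

definition L2_rel :: "'a measure \<Rightarrow> (('a \<Rightarrow> 'b::euclidean_space) \<times> ('a \<Rightarrow> 'b)) set" where
  "L2_rel M = {(f, g). f \<in> L2_fun M \<and> g \<in> L2_fun M \<and> (AE x in M. f x = g x)}"

definition L2 :: "'a measure \<Rightarrow> ('a \<Rightarrow> 'b::euclidean_space) set set" where
  "L2 M = L2_fun M // L2_rel M"

definition L2_class :: "'a measure \<Rightarrow> ('a \<Rightarrow> 'b::euclidean_space) \<Rightarrow> ('a \<Rightarrow> 'b) set" where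
  "L2_class M f = L2_rel M `` {f}"

definition L2_rep :: "('a \<Rightarrow> 'b) set \<Rightarrow> 'a \<Rightarrow> 'b" where
  "L2_rep F = (SOME f. f \<in> F)"

definition L2_add ::
  "'a measure \<Rightarrow> ('a \<Rightarrow> 'b::euclidean_space) set \<Rightarrow> ('a \<Rightarrow> 'b) set \<Rightarrow> ('a \<Rightarrow> 'b) set" where
  "L2_add M F G = L2_class M (\<lambda>x. L2_rep F x + L2_rep G x)"

definition L2_scale ::
  "'a measure \<Rightarrow> real \<Rightarrow> ('a \<Rightarrow> 'b::euclidean_space) set \<Rightarrow> ('a \<Rightarrow> 'b) set" where
  "L2_scale M c F = L2_class M (\<lambda>x. c *\<^sub>R L2_rep F x)"

definition L2_dist ::
  "'a measure \<Rightarrow> ('a \<Rightarrow> 'b::euclidean_space) set \<Rightarrow> ('a \<Rightarrow> 'b) set \<Rightarrow> real" where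
  "L2_dist M F G = sqrt (\<integral>x. (norm (L2_rep F x - L2_rep G x))\<^sup>2 \<partial>M)"

text \<open>A compact operator is linear and maps bounded sets to relatively compact sets.
  Boundedness need not be required separately, since it follows.\<close>

definition L2_compact_operator ::
  "'a measure \<Rightarrow> (('a \<Rightarrow> 'b::euclidean_space) set \<Rightarrow> ('a \<Rightarrow> 'b) set) \<Rightarrow> bool" where
  "L2_compact_operator M T \<longleftrightarrow>
     T \<in> L2 M \<rightarrow> L2 M \<and>
     (\<forall>F\<in>L2 M. \<forall>G\<in>L2 M. T (L2_add M F G) = L2_add M (T F) (T G)) \<and>
     (\<forall>c. \<forall>F\<in>L2 M. T (L2_scale M c F) = L2_scale M c (T F)) \<and>
     (\<forall>B. Metric_space.mbounded (L2 M) (L2_dist M) B \<longrightarrow>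
        compactin (Metric_space.mtopology (L2 M) (L2_dist M))
          (Metric_space.mtopology (L2 M) (L2_dist M) closure_of (T ` B)))"

definition Linf_fun :: "'a measure \<Rightarrow> ('a \<Rightarrow> 'b::euclidean_space) set" where
  "Linf_fun M = {f \<in> borel_measurable M. \<exists>K. AE x in M. norm (f x) \<le> K}"


section \<open>The renewal equation and its evolution operator\<close>

definition renewal_solution ::
  "real \<Rightarrow> real \<Rightarrow> (real \<Rightarrow> real \<Rightarrow> real^'n^'n) \<Rightarrow> real \<Rightarrow> (real \<Rightarrow> real^'n) \<Rightarrow> (real \<Rightarrow> real^'n) \<Rightarrow> bool"
where
  "renewal_solution \<tau> h C s \<phi> x \<longleftrightarrow>
     x \<in> L2_fun (lebesgue_on {s - \<tau>..s + h}) \<and>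
     (AE t in lebesgue_on {s..s + h}.
        x t = (\<integral>\<theta>. C t \<theta> *v x (t + \<theta>) \<partial>lebesgue_on {-\<tau>..0})) \<and>
     (AE \<theta> in lebesgue_on {-\<tau>..0}. x (s + \<theta>) = \<phi> \<theta>)"

text \<open>\<open>evolution \<tau> h C t s\<close> is $T(t,s)$, for $s \le t \le s + h$, acting on classes in
  $L^2([-\tau,0])$. The solution is unique only up to a null set, so the description operator
  ranges over the class of the segment $x_t$, not over $x$ itself.\<close>

definition evolution ::
  "real \<Rightarrow> real \<Rightarrow> (real \<Rightarrow> real \<Rightarrow> real^'n^'n) \<Rightarrow> real \<Rightarrow> real \<Rightarrow>
     (real \<Rightarrow> real^'n) set \<Rightarrow> (real \<Rightarrow> real^'n) set"
where
  "evolution \<tau> h C t s \<Phi> =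
     (THE \<Psi>. \<exists>\<phi>\<in>\<Phi>. \<exists>x. renewal_solution \<tau> h C s \<phi> x \<and>
        \<Psi> = L2_class (lebesgue_on {-\<tau>..0}) (\<lambda>\<theta>. x (t + \<theta>)))"


section \<open>Basic facts about $L^2$\<close>

lemma L2_fun_lincomb:
  assumes f: "f \<in> L2_fun M" and g: "g \<in> L2_fun M"
  shows "(\<lambda>x. a *\<^sub>R f x + b *\<^sub>R g x) \<in> L2_fun M"
proof -
  have [measurable]: "f \<in> borel_measurable M" "g \<in> borel_measurable M"
    and i: "integrable M (\<lambda>x. (norm (f x))\<^sup>2)" "integrable M (\<lambda>x. (norm (g x))\<^sup>2)"
    using f g by (auto simp: L2_fun_def)
  have bnd: "(norm (a *\<^sub>R u + b *\<^sub>R v))\<^sup>2 \<le> 2 * a\<^sup>2 * (norm u)\<^sup>2 + 2 * b\<^sup>2 * (norm v)\<^sup>2" for u v :: 'b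
  proof -
    have "(norm (a *\<^sub>R u + b *\<^sub>R v))\<^sup>2 \<le> (\<bar>a\<bar> * norm u + \<bar>b\<bar> * norm v)\<^sup>2"
      by (rule power_mono) (use norm_triangle_ineq[of "a *\<^sub>R u" "b *\<^sub>R v"] in auto)
    also have "\<dots> \<le> 2 * (\<bar>a\<bar> * norm u)\<^sup>2 + 2 * (\<bar>b\<bar> * norm v)\<^sup>2"
      using sum_squares_bound[of "\<bar>a\<bar> * norm u" "\<bar>b\<bar> * norm v"]
      by (simp add: power2_sum)
    finally show ?thesis by (simp add: power_mult_distrib)
  qed
  have "integrable M (\<lambda>x. (norm (a *\<^sub>R f x + b *\<^sub>R g x))\<^sup>2)"
    by (rule Bochner_Integration.integrable_bound
          [where f = "\<lambda>x. 2 * a\<^sup>2 * (norm (f x))\<^sup>2 + 2 * b\<^sup>2 * (norm (g x))\<^sup>2"])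
      (use i bnd in \<open>auto intro!: AE_I2 order_trans[OF _ abs_ge_self]\<close>)
  then show ?thesis by (simp add: L2_fun_def)
qed

lemma equiv_L2_rel: "equiv (L2_fun M) (L2_rel M)"
  unfolding equiv_def refl_on_def sym_def trans_def L2_rel_def by auto

lemma L2_class_in: "f \<in> L2_fun M \<Longrightarrow> L2_class M f \<in> L2 M"
  by (simp add: L2_class_def L2_def quotientI)

lemma L2_class_eq_iff:
  "f \<in> L2_fun M \<Longrightarrow> g \<in> L2_fun M \<Longrightarrow> L2_class M f = L2_class M g \<longleftrightarrow> (AE x in M. f x = g x)"
  by (simp add: L2_class_def eq_equiv_class_iff[OF equiv_L2_rel]) (simp add: L2_rel_def)

lemma L2_rep_mem: "F \<in> L2 M \<Longrightarrow> L2_rep F \<in> F"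
  unfolding L2_rep_def L2_def
  using in_quotient_imp_non_empty[OF equiv_L2_rel] some_in_eq by blast

lemma L2_rep_fun: "F \<in> L2 M \<Longrightarrow> L2_rep F \<in> L2_fun M"
  using L2_rep_mem in_quotient_imp_subset[OF equiv_L2_rel] unfolding L2_def by blast

lemma L2_class_rep:
  assumes "F \<in> L2 M"
  shows "L2_class M (L2_rep F) = F"
proof -
  obtain f where "F = L2_rel M `` {f}" using assms unfolding L2_def by (rule quotientE)
  then have "(f, L2_rep F) \<in> L2_rel M" using L2_rep_mem[OF assms] by simp
  then show ?thesis
    unfolding L2_class_def \<open>F = _\<close> by (rule equiv_class_eq[OF equiv_L2_rel, symmetric])
qed

lemma L2_rep_class:
  assumes "f \<in> L2_fun M"
  shows "AE x in M. L2_rep (L2_class M f) x = f x"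
  using assms L2_class_eq_iff L2_class_in L2_class_rep L2_rep_fun by blast

lemma L2_add_class:
  assumes "f \<in> L2_fun M" "g \<in> L2_fun M"
  shows "L2_add M (L2_class M f) (L2_class M g) = L2_class M (\<lambda>x. f x + g x)"
proof -
  let ?f = "L2_rep (L2_class M f)" and ?g = "L2_rep (L2_class M g)"
  have "?f \<in> L2_fun M" "?g \<in> L2_fun M" using assms by (auto intro: L2_rep_fun L2_class_in)
  from L2_fun_lincomb[OF this, of 1 1] L2_fun_lincomb[OF assms, of 1 1]
  have "(\<lambda>x. ?f x + ?g x) \<in> L2_fun M" "(\<lambda>x. f x + g x) \<in> L2_fun M" by simp_all
  moreover have "AE x in M. ?f x + ?g x = f x + g x"
    using L2_rep_class[OF assms(1)] L2_rep_class[OF assms(2)] by eventually_elim simp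
  ultimately show ?thesis by (simp add: L2_add_def L2_class_eq_iff)
qed

lemma L2_scale_class:
  assumes "f \<in> L2_fun M"
  shows "L2_scale M c (L2_class M f) = L2_class M (\<lambda>x. c *\<^sub>R f x)"
proof -
  let ?f = "L2_rep (L2_class M f)"
  have "?f \<in> L2_fun M" using assms by (auto intro: L2_rep_fun L2_class_in)
  from L2_fun_lincomb[OF this this, of c 0] L2_fun_lincomb[OF assms assms, of c 0]
  have "(\<lambda>x. c *\<^sub>R ?f x) \<in> L2_fun M" "(\<lambda>x. c *\<^sub>R f x) \<in> L2_fun M" by simp_all
  moreover have "AE x in M. c *\<^sub>R ?f x = c *\<^sub>R f x"
    using L2_rep_class[OF assms] by eventually_elim simp
  ultimately show ?thesis by (simp add: L2_scale_def L2_class_eq_iff)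
qed

lemma L2_dist_class:
  assumes "f \<in> L2_fun M" "g \<in> L2_fun M"
  shows "L2_dist M (L2_class M f) (L2_class M g) = sqrt (\<integral>x. (norm (f x - g x))\<^sup>2 \<partial>M)"
proof -
  let ?f = "L2_rep (L2_class M f)" and ?g = "L2_rep (L2_class M g)"
  have r: "?f \<in> L2_fun M" "?g \<in> L2_fun M" using assms by (auto intro: L2_rep_fun L2_class_in)
  have "(\<integral>x. (norm (?f x - ?g x))\<^sup>2 \<partial>M) = (\<integral>x. (norm (f x - g x))\<^sup>2 \<partial>M)"
  proof (rule integral_cong_AE)
    show "AE x in M. (norm (?f x - ?g x))\<^sup>2 = (norm (f x - g x))\<^sup>2"
      using L2_rep_class[OF assms(1)] L2_rep_class[OF assms(2)] by eventually_elim simp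
  qed (use r assms in \<open>auto simp: L2_fun_def intro!: borel_measurable_power
         borel_measurable_norm borel_measurable_diff\<close>)
  then show ?thesis by (simp add: L2_dist_def)
qed

lemma L2_norm_triangle:
  assumes f: "f \<in> L2_fun M" and g: "g \<in> L2_fun M"
  shows "sqrt (\<integral>x. (norm (f x + g x))\<^sup>2 \<partial>M)
       \<le> sqrt (\<integral>x. (norm (f x))\<^sup>2 \<partial>M) + sqrt (\<integral>x. (norm (g x))\<^sup>2 \<partial>M)"
proof -
  define A where "A = (\<integral>x. (norm (f x))\<^sup>2 \<partial>M)"
  define B where "B = (\<integral>x. (norm (g x))\<^sup>2 \<partial>M)"
  have [measurable]: "f \<in> borel_measurable M" "g \<in> borel_measurable M"
    and i: "integrable M (\<lambda>x. (norm (f x))\<^sup>2)" "integrable M (\<lambda>x. (norm (g x))\<^sup>2)"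
    using f g by (auto simp: L2_fun_def)
  have nn: "0 \<le> A" "0 \<le> B" by (simp_all add: A_def B_def)
  have ifg: "integrable M (\<lambda>x. (norm (f x + g x))\<^sup>2)"
    using L2_fun_lincomb[OF f g, of 1 1] by (simp add: L2_fun_def)
  have le: "(\<integral>x. (norm (f x + g x))\<^sup>2 \<partial>M) \<le> (1 + e) * A + (1 + 1 / e) * B" if e: "e > 0" for e
  proof -
    have "(norm (u + v))\<^sup>2 \<le> (1 + e) * (norm u)\<^sup>2 + (1 + 1 / e) * (norm v)\<^sup>2" for u v :: 'b
    proof -
      have "(norm (u + v))\<^sup>2 \<le> (norm u + norm v)\<^sup>2"
        by (rule power_mono) (auto simp: norm_triangle_ineq)
      moreover have "2 * norm u * norm v \<le> e * (norm u)\<^sup>2 + (1 / e) * (norm v)\<^sup>2"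
      proof -
        have "0 \<le> (e * norm u - norm v)\<^sup>2 / e" using e by simp
        also have "\<dots> = e * (norm u)\<^sup>2 + (1 / e) * (norm v)\<^sup>2 - 2 * norm u * norm v"
          using e by (simp add: field_simps power2_eq_square)
        finally show ?thesis by simp
      qed
      ultimately show ?thesis by (simp add: power2_sum algebra_simps)
    qed
    then have "(\<integral>x. (norm (f x + g x))\<^sup>2 \<partial>M)
        \<le> (\<integral>x. (1 + e) * (norm (f x))\<^sup>2 + (1 + 1 / e) * (norm (g x))\<^sup>2 \<partial>M)"
      by (intro integral_mono ifg) (use i in auto)
    then show ?thesis using i by (simp add: A_def B_def)
  qed
  have le': "(\<integral>x. (norm (f x + g x))\<^sup>2 \<partial>M) \<le> (sqrt A + sqrt B)\<^sup>2"
  proof (rule field_le_epsilon)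
    fix d :: real assume d: "0 < d"
    define K where "K = sqrt A + sqrt B + 1"
    have K: "K \<ge> 1" using nn by (simp add: K_def)
    define r where "r = min 1 (d / (2 * K))"
    have r: "0 < r" "r \<le> 1" "2 * K * r \<le> d" using d K by (auto simp: r_def min_def field_simps)
    define a where "a = sqrt A + r / 2"
    define b where "b = sqrt B + r / 2"
    have ab: "0 < a" "0 < b" using nn r by (auto simp: a_def b_def add_nonneg_pos)
    have Aa: "A \<le> a\<^sup>2" using nn r power_mono[of "sqrt A" a 2] by (simp add: a_def)
    have Bb: "B \<le> b\<^sup>2" using nn r power_mono[of "sqrt B" b 2] by (simp add: b_def)
    have "(\<integral>x. (norm (f x + g x))\<^sup>2 \<partial>M) \<le> (1 + b / a) * A + (1 + 1 / (b / a)) * B"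
      using ab by (intro le) simp
    also have "\<dots> \<le> (1 + b / a) * a\<^sup>2 + (1 + 1 / (b / a)) * b\<^sup>2"
      using ab Aa Bb by (intro add_mono mult_left_mono) auto
    also have "\<dots> = (a + b)\<^sup>2"
      using ab by (simp add: field_simps power2_eq_square)
    also have "\<dots> = (sqrt A + sqrt B + r)\<^sup>2" by (simp add: a_def b_def add_ac)
    also have "\<dots> \<le> (sqrt A + sqrt B)\<^sup>2 + 2 * K * r"
    proof -
      have "r * r \<le> 1 * r" using r by (intro mult_right_mono) auto
      then show ?thesis using r by (simp add: K_def power2_eq_square algebra_simps)
    qed
    also have "\<dots> \<le> (sqrt A + sqrt B)\<^sup>2 + d" using r by simp
    finally show "(\<integral>x. (norm (f x + g x))\<^sup>2 \<partial>M) \<le> (sqrt A + sqrt B)\<^sup>2 + d" .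
  qed
  show ?thesis using real_sqrt_le_mono[OF le'] nn by (simp add: A_def B_def)
qed

lemma Metric_space_L2: "Metric_space (L2 M) (L2_dist M)"
proof
  fix F G :: "('a \<Rightarrow> 'b::euclidean_space) set"
  show "0 \<le> L2_dist M F G" by (simp add: L2_dist_def)
  show "L2_dist M F G = L2_dist M G F" by (simp add: L2_dist_def norm_minus_commute)
next
  fix F G :: "('a \<Rightarrow> 'b::euclidean_space) set"
  assume FG: "F \<in> L2 M" "G \<in> L2 M"
  note r = L2_rep_fun[OF FG(1)] L2_rep_fun[OF FG(2)]
  have "integrable M (\<lambda>x. (norm (L2_rep F x - L2_rep G x))\<^sup>2)"
    using L2_fun_lincomb[OF r, of 1 "-1"] by (simp add: L2_fun_def)
  then have "L2_dist M F G = 0 \<longleftrightarrow> (AE x in M. L2_rep F x = L2_rep G x)"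
    by (simp add: L2_dist_def integral_nonneg_eq_0_iff_AE)
  also have "\<dots> \<longleftrightarrow> F = G"
    using L2_class_eq_iff[OF r] by (simp add: L2_class_rep FG)
  finally show "L2_dist M F G = 0 \<longleftrightarrow> F = G" .
next
  fix F G H :: "('a \<Rightarrow> 'b::euclidean_space) set"
  assume FGH: "F \<in> L2 M" "G \<in> L2 M" "H \<in> L2 M"
  note r = FGH[THEN L2_rep_fun]
  have "(\<lambda>x. L2_rep F x - L2_rep G x) \<in> L2_fun M" "(\<lambda>x. L2_rep G x - L2_rep H x) \<in> L2_fun M"
    using L2_fun_lincomb[OF r(1,2), of 1 "-1"] L2_fun_lincomb[OF r(2,3), of 1 "-1"] by simp_all
  from L2_norm_triangle[OF this]
  show "L2_dist M F H \<le> L2_dist M F G + L2_dist M G H" by (simp add: L2_dist_def)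
qed

end

theory Submission
  imports Defs "HOL-Complex_Analysis.Great_Picard"
begin

text \<open>The kernel \<open>k t u = C t (u - t)\<close> turns the equation for \<open>t \<ge> s\<close> into \<open>x = V x\<close>, where
  \<open>V\<close> is the Volterra operator with bounded kernel \<open>k\<close>. Since \<open>h \<ge> \<tau>\<close>, the final segment of
  a solution is a restriction of \<open>V x\<close>, and \<open>x\<close> is bounded in \<open>L\<^sup>2\<close> in terms of the initial
  function. A bounded sequence of solutions \<open>x n\<close> has a subsequence whose integrals against
  each bounded function converge. Applied to the functions \<open>k t\<close>, this makes \<open>V (x n)\<close>
  converge pointwise, and since the \<open>V (x n)\<close> are uniformly bounded, dominated convergence gives
  convergence in \<open>L\<^sup>2\<close>. The pointwise limit is itself the limit in \<open>L\<^sup>2\<close>, so that neither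
  completeness nor the Riesz representation theorem is needed.\<close>

subsection \<open>Weakly convergent subsequences\<close>

text \<open>\<open>C\<close> is merely bounded and measurable, so \<open>V x\<close> need not be
  continuous in \<open>t\<close>, and an Arzela-Ascoli argument is out of reach. The gain comes from
  the integration in \<open>u\<close>: each value \<open>V x t\<close> is a finite combination of
  pairings of \<open>x\<close> with bounded functions, so it follows weak convergence of
  \<open>x\<close> at every single \<open>t\<close>. The condition \<open>h \<ge> \<tau>\<close>
  places the whole final segment in the time range where \<open>x = V x\<close>; a shorter step
  would merely translate a piece of the initial function, and translation gains no compactness.
  Pointwise statements require null sets to be disposed of early: \<open>C\<close> is replaced by a
  Borel kernel that is bounded everywhere, and solutions by Borel functions on the whole line with
  \<open>x t = V x t\<close> at every \<open>t \<ge> s\<close>. The bound on \<open>x\<close> holds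
  for arbitrarily large \<open>h\<close> because the supremum norm carries an exponential weight of
  rate \<open>2 * K\<close>. The initial function is only square integrable and lies outside that
  weighted space; it enters through a source term \<open>V f\<close>, which lies inside.\<close>

lemma convergent_if_uniformly_approx:
  fixes f :: "nat \<Rightarrow> 'b::banach"
  assumes "\<And>e. 0 < e \<Longrightarrow> \<exists>g. convergent g \<and> (\<forall>n. norm (f n - g n) \<le> e)"
  shows "convergent f"
proof (rule Cauchy_convergent, rule metric_CauchyI)
  fix e :: real assume "0 < e"
  then obtain g where g: "convergent g" and fg: "\<And>n. norm (f n - g n) \<le> e / 4"
    using assms[of "e / 4"] by auto
  obtain N where N: "\<And>m n. m \<ge> N \<Longrightarrow> n \<ge> N \<Longrightarrow> dist (g m) (g n) < e / 4"
    using metric_CauchyD[OF convergent_Cauchy[OF g], of "e / 4"] \<open>0 < e\<close> by auto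
  have "dist (f m) (f n) < e" if "m \<ge> N" "n \<ge> N" for m n
  proof -
    have "dist (f m) (f n) \<le> dist (f m) (g m) + dist (g m) (g n) + dist (g n) (f n)"
      by (smt (verit) dist_triangle)
    then show ?thesis
      using N[OF that] fg[of m] fg[of n] \<open>0 < e\<close> by (simp add: dist_norm norm_minus_commute)
  qed
  then show "\<exists>N. \<forall>m\<ge>N. \<forall>n\<ge>N. dist (f m) (f n) < e" by blast
qed

text \<open>On a set of finite measure L2 lies in L1: pointwise
  \<open>r \<le> r\<^sup>2 + 1\<close>, with the summand 1 charged only on
  \<open>{c..b}\<close>.\<close>

lemma integrable_if_L2_compact_support:
  fixes x :: "real \<Rightarrow> 'b::euclidean_space"
  assumes x: "x \<in> L2_fun lborel" and supp: "\<And>u. u \<notin> {c..b} \<Longrightarrow> x u = 0"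
  shows "integrable lborel x"
proof (rule Bochner_Integration.integrable_bound)
  show "integrable lborel (\<lambda>u. (norm (x u))\<^sup>2 + indicator {c..b} u)"
    using x by (intro Bochner_Integration.integrable_add integrable_real_indicator)
      (auto simp: L2_fun_def emeasure_lborel_Icc_eq)
  have "norm (x u) \<le> (norm (x u))\<^sup>2 + indicator {c..b} u" for u
  proof (cases "u \<in> {c..b}")
    case True
    have "0 \<le> (norm (x u) - 1)\<^sup>2 + (norm (x u))\<^sup>2 + 1" by simp
    then have "2 * norm (x u) \<le> 2 * (norm (x u))\<^sup>2 + 2" by (simp add: power2_eq_square algebra_simps)
    then show ?thesis using True by simp
  qed (use supp in simp)
  then show "AE u in lborel. norm (x u) \<le> norm ((norm (x u))\<^sup>2 + indicator {c..b} u)"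
    by (intro AE_I2) simp
qed (use x in \<open>simp add: L2_fun_def\<close>)

text \<open>Taking \<open>e\<close> small first and the measure of \<open>A\<close> small afterwards gives the uniform
  integrability of \<open>L\<^sup>2\<close>-bounded sequences.\<close>

lemma norm_set_integral_le_AM_GM:
  fixes x :: "real \<Rightarrow> 'b::euclidean_space"
  assumes x: "x \<in> L2_fun lborel" and supp: "\<And>u. u \<notin> {c..b} \<Longrightarrow> x u = 0"
    and [measurable]: "A \<in> sets borel" and e: "0 < e"
  shows "(\<integral>u. indicator A u * norm (x u) \<partial>lborel)
    \<le> (e * (\<integral>u. (norm (x u))\<^sup>2 \<partial>lborel) + measure lborel (A \<inter> {c..b}) / e) / 2"
proof -
  have i2: "integrable lborel (\<lambda>u. (norm (x u))\<^sup>2)" using x by (simp add: L2_fun_def)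
  have ix: "integrable lborel x" by (rule integrable_if_L2_compact_support[OF x supp])
  have fin: "emeasure lborel (A \<inter> {c..b}) < \<infinity>"
    by (rule le_less_trans[OF emeasure_mono[of _ "{c..b}"]]) (auto simp: emeasure_lborel_Icc_eq)
  have "(\<integral>u. indicator A u * norm (x u) \<partial>lborel)
     \<le> (\<integral>u. (e * (norm (x u))\<^sup>2 + indicator (A \<inter> {c..b}) u / e) / 2 \<partial>lborel)"
  proof (rule integral_mono)
    show "integrable lborel (\<lambda>u. indicator A u * norm (x u))"
      using integrable_mult_indicator[of A lborel "\<lambda>u. norm (x u)"] ix by simp
    show "integrable lborel (\<lambda>u. (e * (norm (x u))\<^sup>2 + indicator (A \<inter> {c..b}) u / e) / 2)"
      using i2 fin by (intro integrable_divide Bochner_Integration.integrable_add integrable_mult_right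
        integrable_real_indicator) auto
    fix u
    show "indicator A u * norm (x u) \<le> (e * (norm (x u))\<^sup>2 + indicator (A \<inter> {c..b}) u / e) / 2"
    proof (cases "u \<in> A \<inter> {c..b}")
      case True
      have "0 \<le> (e * norm (x u) - 1)\<^sup>2 / e" using e by simp
      also have "\<dots> = e * (norm (x u))\<^sup>2 - 2 * norm (x u) + 1 / e"
        using e by (simp add: field_simps power2_eq_square)
      finally show ?thesis using True by simp
    next
      case False
      then show ?thesis using supp[of u] e by (auto simp: indicator_def)
    qed
  qed
  also have "\<dots> = (e * (\<integral>u. (norm (x u))\<^sup>2 \<partial>lborel) + measure lborel (A \<inter> {c..b}) / e) / 2"
    using i2 fin by simp
  finally show ?thesis .
qed

text \<open>Dynkin's argument: the sets over which the integrals converge form a lambda-system, and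
  the half-lines with rational end points generate the Borel sets, are stable under intersection,
  and are countable, so that a diagonal sequence can supply \<open>gen\<close>. The L2 bound enters
  at countable unions, where it makes the integrals over the tails small uniformly in
  \<open>n\<close>.\<close>

lemma convergent_set_integrals:
  fixes x :: "nat \<Rightarrow> real \<Rightarrow> 'b::euclidean_space"
  assumes x: "\<And>n. x n \<in> L2_fun lborel" and supp: "\<And>n u. u \<notin> {c..b} \<Longrightarrow> x n u = 0"
    and bnd: "\<And>n. (\<integral>u. (norm (x n u))\<^sup>2 \<partial>lborel) \<le> R"
    and gen: "\<And>q. q \<in> \<rat> \<Longrightarrow> convergent (\<lambda>n. \<integral>u. indicator {..<q} u *\<^sub>R x n u \<partial>lborel)"
      "convergent (\<lambda>n. \<integral>u. x n u \<partial>lborel)"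
    and A: "A \<in> sets borel"
  shows "convergent (\<lambda>n. \<integral>u. indicator A u *\<^sub>R x n u \<partial>lborel)"
proof -
  have ix: "integrable lborel (x n)" for n
    by (rule integrable_if_L2_compact_support[OF x supp])
  have ii: "integrable lborel (\<lambda>u. indicator A u *\<^sub>R x n u)" if "A \<in> sets borel" for A n
    using ix that by (intro integrable_mult_indicator) auto
  let ?G = "lessThan ` (\<rat> :: real set)"
  have gb: "sets borel = sigma_sets UNIV ?G"
  proof -
    have "(borel :: real measure) = sigma UNIV ?G"
      unfolding borel_Iio
    proof (intro sigma_eqI sigma_sets_eqI)
      fix A :: "real set" assume "A \<in> range lessThan"
      then obtain r where A: "A = {..<r}" by auto
      have "{..<r} = (\<Union>q\<in>\<rat> \<inter> {..<r}. {..<q})"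
        by (auto dest: Rats_dense_in_real)
      also have "\<dots> \<in> sigma_sets UNIV ?G"
        by (rule sigma_sets_UNION) (auto simp: countable_rat countable_Int1)
      finally show "A \<in> sigma_sets UNIV ?G" by (simp add: A)
    qed auto
    then have "sets borel = sets (sigma UNIV ?G)" by (rule arg_cong)
    then show ?thesis by (subst (asm) sets_measure_of) simp_all
  qed
  have "{..<p} \<inter> {..<q} = {..<min p q}" "min p q \<in> {p, q}" for p q :: real
    by (auto simp: min_def)
  then have "Int_stable ?G"
    unfolding Int_stable_def by (smt (verit) image_iff insertE singletonD)
  moreover have "?G \<subseteq> Pow UNIV" by simp
  moreover have "A \<in> sigma_sets UNIV ?G" using A by (simp add: gb)
  ultimately show ?thesis
  proof (induction rule: sigma_sets_induct_disjoint)
    case (basic A)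
    then show ?case using gen(1) by auto
  next
    case empty
    then show ?case by (simp add: convergent_const)
  next
    case (compl A)
    then have [measurable]: "A \<in> sets borel" by (simp add: gb)
    have "(\<integral>u. indicator (UNIV - A) u *\<^sub>R x n u \<partial>lborel)
       = (\<integral>u. x n u \<partial>lborel) - (\<integral>u. indicator A u *\<^sub>R x n u \<partial>lborel)" for n
      by (subst Bochner_Integration.integral_diff[symmetric, OF ix ii])
        (auto intro!: Bochner_Integration.integral_cong split: split_indicator)
    then show ?case using convergent_diff[OF gen(2) compl(2)] by simp
  next
    case (union A)
    have [measurable]: "A i \<in> sets borel" for i using union(2) by (auto simp: gb)
    \<comment> \<open>What remains of the union after its first \<open>N\<close> sets. Intersecting
      it with \<open>{c..b}\<close> supplies the finite measure that continuity from above
      requires.\<close>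
    define E where "E N = (\<Union>i. A i) - (\<Union>i<N. A i)" for N :: nat
    have [measurable]: "E N \<in> sets borel" for N by (simp add: E_def)
    have E0: "(\<lambda>N. measure lborel (E N \<inter> {c..b})) \<longlonglongrightarrow> 0"
    proof -
      have "(\<lambda>N. measure lborel (E N \<inter> {c..b})) \<longlonglongrightarrow> measure lborel (\<Inter>N. E N \<inter> {c..b})"
      proof (rule Lim_measure_decseq)
        show "decseq (\<lambda>N. E N \<inter> {c..b})" by (fastforce simp: decseq_def E_def)
        show "emeasure lborel (E N \<inter> {c..b}) \<noteq> \<infinity>" for N
          using le_less_trans[OF emeasure_mono[of "E N \<inter> {c..b}" "{c..b}" lborel]]
          by (auto simp: emeasure_lborel_Icc_eq less_top)
      qed auto
      moreover have "(\<Inter>N. E N \<inter> {c..b}) = {}" by (auto simp: E_def)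
      ultimately show ?thesis by simp
    qed
    have R: "R \<ge> 0" using order_trans[OF _ bnd[of 0]] by simp
    show ?case
    proof (rule convergent_if_uniformly_approx)
      fix e :: real assume e: "0 < e"
      \<comment> \<open>With this \<open>d\<close>, and \<open>N\<close> chosen next, the two terms
        \<open>d * R\<close> and measure divided by \<open>d\<close> of the AM-GM bound are each at
        most \<open>e\<close>; the \<open>+ 1\<close> covers \<open>R = 0\<close>.\<close>
      define d where "d = e / (R + 1)"
      have d: "0 < d" "d * R \<le> e" using e R by (auto simp: d_def field_simps)
      obtain N where N: "measure lborel (E N \<inter> {c..b}) < d * e"
        using order_tendstoD(2)[OF E0, of "d * e"] d e
        by (auto simp: eventually_sequentially)
      let ?g = "\<lambda>n. \<Sum>i<N. \<integral>u. indicator (A i) u *\<^sub>R x n u \<partial>lborel"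
      have "convergent ?g" by (intro convergent_sum union)
      moreover have "norm ((\<integral>u. indicator (\<Union>i. A i) u *\<^sub>R x n u \<partial>lborel) - ?g n) \<le> e" for n
      proof -
        have "?g n = (\<integral>u. indicator (\<Union>i<N. A i) u *\<^sub>R x n u \<partial>lborel)"
        proof -
          have "indicator (\<Union>i<N. A i) u = (\<Sum>i<N. indicator (A i) u :: real)" for u
            using union(1) by (intro indicator_UN_disjoint) (auto intro: disjoint_family_on_mono)
          then have "indicator (\<Union>i<N. A i) u *\<^sub>R x n u = (\<Sum>i<N. indicator (A i) u *\<^sub>R x n u)" for u
            by (simp only: scaleR_sum_left)
          then show ?thesis
            by (simp only:) (rule Bochner_Integration.integral_sum[symmetric], rule ii, simp)
        qed
        then have "(\<integral>u. indicator (\<Union>i. A i) u *\<^sub>R x n u \<partial>lborel) - ?g n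
            = (\<integral>u. indicator (E N) u *\<^sub>R x n u \<partial>lborel)"
          by (simp only:, subst Bochner_Integration.integral_diff[symmetric])
            (auto intro!: ii Bochner_Integration.integral_cong simp: E_def split: split_indicator)
        also have "norm \<dots> \<le> (\<integral>u. indicator (E N) u * norm (x n u) \<partial>lborel)"
          using integral_norm_bound[of lborel "\<lambda>u. indicator (E N) u *\<^sub>R x n u"] by simp
        also have "\<dots> \<le> (d * (\<integral>u. (norm (x n u))\<^sup>2 \<partial>lborel) + measure lborel (E N \<inter> {c..b}) / d) / 2"
          by (rule norm_set_integral_le_AM_GM[OF x supp]) (use d in auto)
        also have "\<dots> \<le> (d * R + (d * e) / d) / 2"
          using d N bnd[of n]
          by (intro divide_right_mono add_mono mult_left_mono) (auto intro: less_imp_le)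
        also have "\<dots> \<le> e" using d by simp
        finally show ?thesis .
      qed
      ultimately show "\<exists>g. convergent g \<and>
          (\<forall>n. norm ((\<integral>u. indicator (\<Union>i. A i) u *\<^sub>R x n u \<partial>lborel) - g n) \<le> e)"
        by blast
    qed
  qed
qed

text \<open>Rounding \<open>g\<close> down to multiples of \<open>1 / m\<close> costs at most
  \<open>1 / m\<close> uniformly and leaves finitely many values. Up to an error
  \<open>R / m\<close> the integral is thus a finite combination of integrals over level sets, which
  converge by \<open>sets\<close>.\<close>

lemma convergent_bounded_integrals:
  fixes x :: "nat \<Rightarrow> real \<Rightarrow> 'b::euclidean_space" and g :: "real \<Rightarrow> real"
  assumes ix: "\<And>n. integrable lborel (x n)" and bnd: "\<And>n. (\<integral>u. norm (x n u) \<partial>lborel) \<le> R"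
    and sets: "\<And>A. A \<in> sets borel \<Longrightarrow> convergent (\<lambda>n. \<integral>u. indicator A u *\<^sub>R x n u \<partial>lborel)"
    and [measurable]: "g \<in> borel_measurable borel" and g: "\<And>u. \<bar>g u\<bar> \<le> B"
  shows "convergent (\<lambda>n. \<integral>u. g u *\<^sub>R x n u \<partial>lborel)"
proof (rule convergent_if_uniformly_approx)
  fix e :: real assume e: "0 < e"
  have R: "R \<ge> 0" using order_trans[OF _ bnd[of 0]] by simp
  obtain m where "m > 0" and m: "R / e \<le> m"
    by (meson gt_ex less_imp_le order_trans linear max.cobounded1 max.strict_coboundedI2)
  have [measurable]: "x n \<in> borel_measurable borel" for n
    using borel_measurable_integrable[OF ix] by simp
  define J where "J = {- \<lceil>m * B\<rceil> - 1 .. \<lceil>m * B\<rceil>}"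
  define A where "A j = {u. \<lfloor>m * g u\<rfloor> = j}" for j
  have [measurable]: "A j \<in> sets borel" for j unfolding A_def by measurable
  have J: "\<lfloor>m * g u\<rfloor> \<in> J" for u
  proof -
    have "\<bar>m * g u\<bar> \<le> m * B" using g[of u] \<open>m > 0\<close> by (simp add: abs_mult)
    then show ?thesis unfolding J_def by simp linarith
  qed
  have ap: "(\<Sum>j\<in>J. (real_of_int j / m) * indicator (A j) u) = \<lfloor>m * g u\<rfloor> / m" for u
  proof -
    have "(\<Sum>j\<in>J. (real_of_int j / m) * indicator (A j) u)
        = (\<Sum>j\<in>J. if j = \<lfloor>m * g u\<rfloor> then real_of_int j / m else 0)"
      by (intro sum.cong) (auto simp: A_def indicator_def)
    also have "\<dots> = \<lfloor>m * g u\<rfloor> / m" using J by (simp add: J_def)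
    finally show ?thesis .
  qed
  have ii: "integrable lborel (\<lambda>u. indicator A u *\<^sub>R x n u)" if "A \<in> sets borel" for A n
    using ix that by (intro integrable_mult_indicator) auto
  let ?h = "\<lambda>n. \<Sum>j\<in>J. (real_of_int j / m) *\<^sub>R (\<integral>u. indicator (A j) u *\<^sub>R x n u \<partial>lborel)"
  have "convergent ?h"
  proof (rule convergent_sum)
    show "convergent (\<lambda>n. (real_of_int j / m) *\<^sub>R (\<integral>u. indicator (A j) u *\<^sub>R x n u \<partial>lborel))" for j
      using sets[of "A j"] by (auto simp: convergent_def intro: tendsto_scaleR[OF tendsto_const])
  qed
  moreover have "norm ((\<integral>u. g u *\<^sub>R x n u \<partial>lborel) - ?h n) \<le> e" for n
  proof -
    have apx: "(\<lfloor>m * g u\<rfloor> / m) *\<^sub>R x n u = (\<Sum>j\<in>J. (real_of_int j / m) *\<^sub>R indicator (A j) u *\<^sub>R x n u)" for u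
      by (simp only: ap[symmetric] scaleR_sum_left scaleR_scaleR)
    have hn: "?h n = (\<integral>u. (\<lfloor>m * g u\<rfloor> / m) *\<^sub>R x n u \<partial>lborel)"
      unfolding apx using ii
      by (subst Bochner_Integration.integral_sum) (auto simp del: scaleR_scaleR intro!: integrable_scaleR_right)
    have i1: "integrable lborel (\<lambda>u. g u *\<^sub>R x n u)"
    proof (rule Bochner_Integration.integrable_bound[of _ "\<lambda>u. B * norm (x n u)"])
      show "AE u in lborel. norm (g u *\<^sub>R x n u) \<le> norm (B * norm (x n u))"
        using g by (intro AE_I2) (smt (verit) mult_right_mono norm_ge_zero norm_scaleR real_norm_def)
    qed (use ix in auto)
    have i2: "integrable lborel (\<lambda>u. (\<lfloor>m * g u\<rfloor> / m) *\<^sub>R x n u)"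
      unfolding apx using ii
      by (intro Bochner_Integration.integrable_sum integrable_scaleR_right) auto
    have "norm ((\<integral>u. g u *\<^sub>R x n u \<partial>lborel) - ?h n)
        = norm (\<integral>u. (g u - \<lfloor>m * g u\<rfloor> / m) *\<^sub>R x n u \<partial>lborel)"
      unfolding hn by (subst Bochner_Integration.integral_diff[symmetric, OF i1 i2]) (simp add: scaleR_diff_left)
    also have "\<dots> \<le> (\<integral>u. (1 / m) * norm (x n u) \<partial>lborel)"
    proof (rule Bochner_Integration.integral_norm_bound_integral)
      show "integrable lborel (\<lambda>u. (g u - \<lfloor>m * g u\<rfloor> / m) *\<^sub>R x n u)"
        using Bochner_Integration.integrable_diff[OF i1 i2] by (simp add: scaleR_diff_left)
      fix u
      have "\<bar>m * g u - \<lfloor>m * g u\<rfloor>\<bar> \<le> 1" by linarith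
      moreover have "g u - \<lfloor>m * g u\<rfloor> / m = (m * g u - \<lfloor>m * g u\<rfloor>) / m"
        using \<open>m > 0\<close> by (simp add: field_simps)
      moreover have "\<bar>(m * g u - \<lfloor>m * g u\<rfloor>) / m\<bar> = \<bar>m * g u - \<lfloor>m * g u\<rfloor>\<bar> / m"
        using \<open>m > 0\<close> by simp
      ultimately have "\<bar>g u - \<lfloor>m * g u\<rfloor> / m\<bar> \<le> 1 / m"
        using \<open>m > 0\<close> by (metis divide_right_mono less_imp_le)
      then show "norm ((g u - \<lfloor>m * g u\<rfloor> / m) *\<^sub>R x n u) \<le> (1 / m) * norm (x n u)"
        unfolding norm_scaleR real_norm_def by (intro mult_right_mono) auto
    qed (use ix in auto)
    also have "\<dots> \<le> R / m" using bnd[of n] \<open>m > 0\<close> by (simp add: divide_right_mono)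
    also have "\<dots> \<le> e" using m \<open>m > 0\<close> e by (simp add: field_simps)
    finally show ?thesis .
  qed
  ultimately show "\<exists>h. convergent h \<and> (\<forall>n. norm ((\<integral>u. g u *\<^sub>R x n u \<partial>lborel) - h n) \<le> e)"
    by blast
qed

text \<open>The integrals over a countable family of sets are bounded by \<open>?M\<close>, so a
  diagonal argument settles them all; the two preceding lemmas pass to Borel sets and then to
  bounded functions. Since \<open>r\<close> is fixed before \<open>g\<close>, it serves uncountably
  many test functions at once.\<close>

lemma L2_bounded_weakly_convergent_subsequence:
  fixes x :: "nat \<Rightarrow> real \<Rightarrow> 'b::euclidean_space"
  assumes x: "\<And>n. x n \<in> L2_fun lborel" and supp: "\<And>n u. u \<notin> {c..b} \<Longrightarrow> x n u = 0"
    and bnd: "\<And>n. (\<integral>u. (norm (x n u))\<^sup>2 \<partial>lborel) \<le> R"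
  obtains r :: "nat \<Rightarrow> nat" where "strict_mono r"
    "\<And>(g :: real \<Rightarrow> real) B. g \<in> borel_measurable borel \<Longrightarrow> (\<And>u. \<bar>g u\<bar> \<le> B) \<Longrightarrow>
       convergent (\<lambda>n. \<integral>u. g u *\<^sub>R x (r n) u \<partial>lborel)"
proof -
  let ?M = "(R + measure lborel {c..b}) / 2"
  have ix: "integrable lborel (x n)" for n
    by (rule integrable_if_L2_compact_support[OF x supp])
  have L1: "(\<integral>u. norm (x n u) \<partial>lborel) \<le> ?M" for n
  proof -
    have "(\<integral>u. indicator UNIV u * norm (x n u) \<partial>lborel)
      \<le> (1 * (\<integral>u. (norm (x n u))\<^sup>2 \<partial>lborel) + measure lborel (UNIV \<inter> {c..b}) / 1) / 2"
      by (rule norm_set_integral_le_AM_GM[OF x supp]) auto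
    then show ?thesis using bnd[of n] by simp
  qed
  \<comment> \<open>\<open>UNIV\<close> joins the half-lines because integrals over complements are
    obtained by subtraction from the integral over the whole line.\<close>
  let ?S = "insert UNIV (lessThan ` (\<rat> :: real set))"
  have "countable ?S" by (simp add: countable_rat)
  moreover have "norm (\<integral>u. indicator A u *\<^sub>R x n u \<partial>lborel) \<le> ?M" if "A \<in> ?S" for n A
  proof -
    have [measurable]: "A \<in> sets borel" using that by auto
    have "norm (\<integral>u. indicator A u *\<^sub>R x n u \<partial>lborel) \<le> (\<integral>u. norm (x n u) \<partial>lborel)"
      using ix by (intro Bochner_Integration.integral_norm_bound_integral integrable_mult_indicator)
        (auto split: split_indicator)
    then show ?thesis using L1[of n] by simp
  qed
  ultimately show thesis
  proof (rule function_convergent_subsequence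
      [where f = "\<lambda>n A. \<integral>u. indicator A u *\<^sub>R x n u \<partial>lborel"])
    fix r :: "nat \<Rightarrow> nat"
    assume r: "strict_mono r"
      and conv: "\<And>A. A \<in> ?S \<Longrightarrow> \<exists>l. (\<lambda>n. \<integral>u. indicator A u *\<^sub>R x (r n) u \<partial>lborel) \<longlonglongrightarrow> l"
    have "convergent (\<lambda>n. \<integral>u. indicator A u *\<^sub>R x (r n) u \<partial>lborel)" if "A \<in> sets borel" for A
    proof (rule convergent_set_integrals[OF x supp bnd _ _ that])
      show "convergent (\<lambda>n. \<integral>u. indicator {..<q} u *\<^sub>R x (r n) u \<partial>lborel)" if "q \<in> \<rat>" for q
        using conv[of "{..<q}"] that by (auto simp: convergent_def)
      show "convergent (\<lambda>n. \<integral>u. x (r n) u \<partial>lborel)"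
        using conv[of UNIV] by (auto simp: convergent_def)
    qed
    from convergent_bounded_integrals[OF ix L1 this]
    show thesis by (intro that[of r] r) blast
  qed
qed

subsection \<open>Volterra operators with bounded kernel\<close>

lemma borel_measurable_matrix_vector_mult [measurable (raw)]:
  fixes f :: "'a \<Rightarrow> real^'n^'m" and g :: "'a \<Rightarrow> real^'n"
  assumes "f \<in> borel_measurable M" "g \<in> borel_measurable M"
  shows "(\<lambda>x. f x *v g x) \<in> borel_measurable M"
  using assms
proof (rule borel_measurable_continuous_Pair)
  show "continuous_on UNIV (\<lambda>p :: (real^'n^'m) \<times> (real^'n). fst p *v snd p)"
    unfolding matrix_vector_mult_def by (intro continuous_on_vec_lambda continuous_intros)
qed

text \<open>Testing on a unit vector. This makes the entries of the kernel bounded scalar functions,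
  the kind of test function for which weak convergence is available.\<close>

lemma component_le_of_matrix_vector_bound:
  fixes A :: "real^'n^'m"
  assumes "\<And>v. norm (A *v v) \<le> K * norm v"
  shows "\<bar>A $ i $ j\<bar> \<le> K"
proof -
  have "\<bar>A $ i $ j\<bar> = norm ((A *v axis j 1) $ i)" by (simp add: matrix_vector_mul_component inner_axis)
  also have "\<dots> \<le> norm (A *v axis j 1)" by (rule Finite_Cartesian_Product.norm_nth_le)
  also have "\<dots> \<le> K" using assms[of "axis j 1"] by simp
  finally show ?thesis .
qed

text \<open>Bound and support are imposed at every point, so that \<open>V f t\<close> is controlled
  for each \<open>t\<close>. Apart from causality \<open>u \<le> t\<close>, only \<open>t\<close> is
  confined to \<open>{a..b}\<close>: before \<open>a\<close> the kernel reads the history.\<close>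

locale volterra_kernel =
  fixes k :: "real \<Rightarrow> real \<Rightarrow> real^'n^'n" and a b K :: real
  assumes k_measurable [measurable]: "(\<lambda>(t, u). k t u) \<in> borel_measurable (borel \<Otimes>\<^sub>M borel)"
    and K_pos: "0 < K"
    and k_bound: "norm (k t u *v v) \<le> K * norm v"
    and k_support: "k t u \<noteq> 0 \<Longrightarrow> a \<le> t \<and> t \<le> b \<and> u \<le> t"
begin

text \<open>The limits of integration are encoded in the support of \<open>k\<close>, which leaves
  one measure for all \<open>t\<close>.\<close>

definition V :: "(real \<Rightarrow> real^'n) \<Rightarrow> real \<Rightarrow> real^'n"
  where "V f t = (\<integral>u. k t u *v f u \<partial>lborel)"

text \<open>With this weight the Volterra operator has norm at most \<open>1/2\<close> on the weighted
  supremum norm, because \<open>\<integral> K exp (2 K (u - a)) du\<close> over \<open>{a..t}\<close> is less than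
  half of \<open>exp (2 K (t - a))\<close>.\<close>

definition weight :: "real \<Rightarrow> real"
  where "weight t = indicator {a..b} t * exp (2 * K * (t - a))"

lemma weight_measurable [measurable]: "weight \<in> borel_measurable borel"
  unfolding weight_def by measurable

lemma weight_nonneg: "0 \<le> weight t"
  by (simp add: weight_def)

lemma weight_le: "weight t \<le> exp (2 * K * (b - a)) * indicator {a..b} t"
  using K_pos by (auto simp: weight_def indicator_def)

lemma integrable_if_le_weight:
  fixes f :: "real \<Rightarrow> real^'n"
  assumes "f \<in> borel_measurable borel" and "\<And>u. norm (f u) \<le> G * weight u"
  shows "integrable lborel f"
proof (rule Bochner_Integration.integrable_bound)
  show "integrable lborel (\<lambda>u. \<bar>G\<bar> * (exp (2 * K * (b - a)) * indicator {a..b} u))"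
    by (intro integrable_mult_right integrable_real_indicator) (auto simp: emeasure_lborel_Icc_eq)
  have "norm (f u) \<le> \<bar>G\<bar> * (exp (2 * K * (b - a)) * indicator {a..b} u)" for u
  proof -
    have "norm (f u) \<le> \<bar>G\<bar> * weight u"
      using assms(2)[of u] mult_right_mono[OF abs_ge_self weight_nonneg, of G u] by linarith
    also have "\<dots> \<le> \<bar>G\<bar> * (exp (2 * K * (b - a)) * indicator {a..b} u)"
      by (intro mult_left_mono weight_le) simp
    finally show ?thesis .
  qed
  then show "AE u in lborel. norm (f u) \<le> norm (\<bar>G\<bar> * (exp (2 * K * (b - a)) * indicator {a..b} u))"
    by (intro AE_I2) simp
qed (use assms in simp)

lemma k_measurable_snd [measurable]: "k t \<in> borel_measurable borel"
  by measurable

lemma integrable_k_mult: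
  assumes "integrable lborel f"
  shows "integrable lborel (\<lambda>u. k t u *v f u)"
proof (rule Bochner_Integration.integrable_bound)
  show "integrable lborel (\<lambda>u. K * norm (f u))" using assms by auto
  have [measurable]: "f \<in> borel_measurable borel"
    using borel_measurable_integrable[OF assms] by simp
  show "(\<lambda>u. k t u *v f u) \<in> borel_measurable lborel" by measurable
  show "AE u in lborel. norm (k t u *v f u) \<le> norm (K * norm (f u))"
    using k_bound K_pos by (intro AE_I2) (simp add: abs_mult)
qed

lemma V_measurable [measurable]:
  assumes [measurable]: "f \<in> borel_measurable borel"
  shows "V f \<in> borel_measurable borel"
  unfolding V_def by measurable

lemma V_outside: "t \<notin> {a..b} \<Longrightarrow> V f t = 0"
proof -
  assume "t \<notin> {a..b}"
  then have "k t u = 0" for u using k_support[of t u] by auto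
  then show ?thesis by (simp add: V_def)
qed

lemma V_lincomb:
  assumes "integrable lborel f" "integrable lborel g"
  shows "V (\<lambda>u. p *\<^sub>R f u + q *\<^sub>R g u) t = p *\<^sub>R V f t + q *\<^sub>R V g t"
  using assms[THEN integrable_k_mult, of t]
  by (simp add: V_def matrix_vector_right_distrib matrix_vector_mult_scaleR)

lemma V_cong_AE:
  assumes [measurable]: "f \<in> borel_measurable borel" "g \<in> borel_measurable borel"
    and "AE u in lborel. f u = g u"
  shows "V f t = V g t"
  unfolding V_def
proof (rule integral_cong_AE)
  show "AE u in lborel. k t u *v f u = k t u *v g u" using assms(3) by eventually_elim simp
qed measurable

lemma V_norm_le:
  assumes "integrable lborel f"
  shows "norm (V f t) \<le> K * (\<integral>u. norm (f u) \<partial>lborel)"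
proof -
  have "norm (V f t) \<le> (\<integral>u. K * norm (f u) \<partial>lborel)"
    unfolding V_def using assms integrable_k_mult k_bound
    by (intro Bochner_Integration.integral_norm_bound_integral) auto
  then show ?thesis by simp
qed

text \<open>The weight is at least 1 on \<open>{a..b}\<close>, so the unweighted bound suffices. Its
  use: \<open>V\<close> carries every integrable function, in particular a history before
  \<open>a\<close>, into the weighted space where iteration contracts.\<close>

lemma V_norm_le_weight:
  assumes "integrable lborel f"
  shows "norm (V f t) \<le> K * (\<integral>u. norm (f u) \<partial>lborel) * weight t"
proof (cases "t \<in> {a..b}")
  case True
  have "K * (\<integral>u. norm (f u) \<partial>lborel) * 1 \<le> K * (\<integral>u. norm (f u) \<partial>lborel) * weight t"
    using True K_pos by (intro mult_left_mono) (auto simp: weight_def)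
  then show ?thesis using V_norm_le[OF assms, of t] by simp
qed (simp add: V_outside weight_def)

lemma V_contraction:
  assumes f: "f \<in> borel_measurable borel" and le: "\<And>u. norm (f u) \<le> G * weight u"
  shows "norm (V f t) \<le> G / 2 * weight t"
proof (cases "t \<in> {a..b}")
  case True
  have fi: "integrable lborel f" by (rule integrable_if_le_weight[OF f le])
  have G: "0 \<le> G"
  proof -
    have "0 \<le> G * weight t" using le[of t] norm_ge_zero[of "f t"] by linarith
    then show ?thesis using True by (simp add: weight_def zero_le_mult_iff)
  qed
  let ?w = "\<lambda>u. (K * G) * (exp (2 * K * (u - a)) * indicator {a..t} u)"
  let ?F = "\<lambda>u. exp (2 * K * (u - a)) / (2 * K)"
  have hb: "has_bochner_integral lborel (\<lambda>u. exp (2 * K * (u - a)) * indicator {a..t} u) (?F t - ?F a)"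
  proof (rule has_bochner_integral_FTC_Icc_real)
    show "DERIV ?F u :> exp (2 * K * (u - a))" for u
      using K_pos by (auto intro!: derivative_eq_intros)
  qed (use True in \<open>auto intro!: continuous_intros\<close>)
  have "norm (V f t) \<le> (\<integral>u. ?w u \<partial>lborel)"
    unfolding V_def
  proof (rule Bochner_Integration.integral_norm_bound_integral)
    show "integrable lborel ?w"
      using hb by (intro integrable_mult_right) (auto simp: has_bochner_integral_iff)
    fix u
    show "norm (k t u *v f u) \<le> ?w u"
    proof (cases "u \<in> {a..t}")
      case u: True
      have "norm (k t u *v f u) \<le> K * norm (f u)" by (rule k_bound)
      also have "\<dots> \<le> K * (G * weight u)" using K_pos le by (intro mult_left_mono) auto
      finally show ?thesis using u True by (simp add: weight_def)
    next
      case False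
      \<comment> \<open>Causality removes \<open>u > t\<close>, the vanishing weight removes
        \<open>u < a\<close>.\<close>
      then have "k t u = 0 \<or> f u = 0"
        using k_support[of t u] le[of u] by (auto simp: weight_def)
      then show ?thesis using False by (auto simp: matrix_vector_mult_0)
    qed
  qed (rule integrable_k_mult[OF fi])
  also have "\<dots> = K * G * (?F t - ?F a)"
    using hb by (simp add: has_bochner_integral_iff)
  also have "\<dots> = G / 2 * (exp (2 * K * (t - a)) - 1)"
    using K_pos by (simp add: field_simps)
  also have "\<dots> \<le> G / 2 * weight t"
    using True G by (intro mult_left_mono) (auto simp: weight_def)
  finally show ?thesis .
qed (simp add: V_outside weight_def)

section \<open>Neumann series: existence and uniqueness for Volterra equations\<close>

lemma V_iterate:
  assumes h: "h \<in> borel_measurable borel" and le: "\<And>u. norm (h u) \<le> G * weight u"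
  shows "(V ^^ n) h \<in> borel_measurable borel \<and> (\<forall>u. norm ((V ^^ n) h u) \<le> G / 2 ^ n * weight u)"
proof (induction n)
  case (Suc n)
  then have "norm (V ((V ^^ n) h) u) \<le> G / 2 ^ n / 2 * weight u" for u
    by (intro V_contraction) auto
  with Suc show ?case by (simp add: V_measurable mult.commute)
qed (use assms in simp)

text \<open>The solution is the sum of the iterates \<open>(V ^^ n) h\<close>, whose bounds
  \<open>G / 2 ^ n\<close> add up to the factor 2. The same geometric bounds, integrated, justify
  exchanging sum and integral in \<open>V y\<close>.\<close>

lemma Volterra_equation_solvable:
  assumes h: "h \<in> borel_measurable borel" and le: "\<And>u. norm (h u) \<le> G * weight u"
  obtains y where "y \<in> borel_measurable borel" "\<And>t. y t = h t + V y t"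
    "\<And>t. norm (y t) \<le> 2 * G * weight t"
proof
  define d where "d n = (V ^^ n) h" for n
  have [measurable]: "d n \<in> borel_measurable borel" and dle: "norm (d n u) \<le> G / 2 ^ n * weight u" for n u
    using V_iterate[OF h le] by (auto simp: d_def)
  have di: "integrable lborel (d n)" for n
    by (rule integrable_if_le_weight[OF _ dle]) measurable
  have geo: "(\<lambda>n. c / 2 ^ n) sums (2 * c)" for c :: real
    using sums_mult[OF geometric_sums[of "1 / 2 :: real"], of c] by (simp add: power_divide mult.commute)
  have sn: "summable (\<lambda>n. norm (d n u))" for u
  proof (rule summable_comparison_test')
    show "summable (\<lambda>n. (G * weight u) / 2 ^ n)" using geo sums_summable by blast
    show "norm (norm (d n u)) \<le> (G * weight u) / 2 ^ n" for n using dle[of n u] by simp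
  qed
  have sd: "summable (\<lambda>n. d n u)" for u by (rule summable_norm_cancel[OF sn])
  define y where "y t = (\<Sum>n. d n t)" for t
  show [measurable]: "y \<in> borel_measurable borel" unfolding y_def by measurable
  show "norm (y t) \<le> 2 * G * weight t" for t
  proof -
    have "norm (y t) \<le> (\<Sum>n. norm (d n t))" unfolding y_def by (rule summable_norm[OF sn])
    also have "\<dots> \<le> (\<Sum>n. (G * weight t) / 2 ^ n)"
      using dle[of _ t] sums_summable[OF geo] by (intro suminf_le sn) auto
    also have "\<dots> = 2 * G * weight t" using sums_unique[OF geo[of "G * weight t"]] by simp
    finally show ?thesis .
  qed
  show "y t = h t + V y t" for t
  proof -
    have "k t u *v y u = (\<Sum>n. k t u *v d n u)" for u
      unfolding y_def by (rule bounded_linear.suminf[OF matrix_vector_mul_bounded_linear sd])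
    then have "V y t = (\<integral>u. (\<Sum>n. k t u *v d n u) \<partial>lborel)" by (simp add: V_def)
    also have "\<dots> = (\<Sum>n. \<integral>u. k t u *v d n u \<partial>lborel)"
    proof (rule integral_suminf)
      show "integrable lborel (\<lambda>u. k t u *v d n u)" for n by (rule integrable_k_mult[OF di])
      show "AE u in lborel. summable (\<lambda>n. norm (k t u *v d n u))"
        using k_bound by (intro AE_I2 summable_comparison_test'[OF summable_mult[OF sn]]) auto
      show "summable (\<lambda>n. \<integral>u. norm (k t u *v d n u) \<partial>lborel)"
      proof (rule summable_comparison_test')
        let ?W = "\<integral>u. weight u \<partial>lborel"
        have wi: "integrable lborel weight"
        proof (rule Bochner_Integration.integrable_bound)
          show "integrable lborel (\<lambda>u. exp (2 * K * (b - a)) * indicator {a..b} u :: real)"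
            by (intro integrable_mult_right integrable_real_indicator) (auto simp: emeasure_lborel_Icc_eq)
          show "AE u in lborel. norm (weight u) \<le> norm (exp (2 * K * (b - a)) * indicator {a..b} u :: real)"
            using weight_le weight_nonneg by (intro AE_I2) simp
        qed simp
        show "summable (\<lambda>n. (K * G * ?W) / 2 ^ n)" using geo sums_summable by blast
        have "(\<integral>u. norm (k t u *v d n u) \<partial>lborel) \<le> (\<integral>u. K * (G / 2 ^ n * weight u) \<partial>lborel)" for n
        proof (rule integral_mono)
          show "norm (k t u *v d n u) \<le> K * (G / 2 ^ n * weight u)" for u
            using k_bound[of t u "d n u"] mult_left_mono[OF dle[of n u] less_imp_le[OF K_pos]] by linarith
        qed (use wi integrable_k_mult[OF di] in auto)
        then show "norm (\<integral>u. norm (k t u *v d n u) \<partial>lborel) \<le> (K * G * ?W) / 2 ^ n" for n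
          by (simp add: mult.assoc)
      qed
    qed
    \<comment> \<open>\<open>V\<close> shifts the series by one index, so \<open>V y\<close> misses
      exactly the term \<open>d 0 = h\<close>.\<close>
    also have "\<dots> = (\<Sum>n. d (Suc n) t)" by (simp add: d_def V_def)
    also have "\<dots> = y t - d 0 t" unfolding y_def by (rule suminf_split_head[OF sd])
    finally show ?thesis by (simp add: d_def)
  qed
qed

text \<open>Here \<open>f\<close> is a history and \<open>y\<close> its continuation. As
  \<open>f\<close> is only integrable, the Neumann series is run for \<open>y\<close> alone, with
  the source \<open>V f\<close>, which obeys the weighted bound.\<close>

lemma Volterra_continuation:
  assumes f: "integrable lborel f"
  obtains y where "y \<in> borel_measurable borel" "\<And>t. y t = V (\<lambda>u. f u + y u) t"
    "\<And>t. norm (y t) \<le> 2 * (K * (\<integral>u. norm (f u) \<partial>lborel)) * weight t"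
proof -
  have [measurable]: "f \<in> borel_measurable borel" using borel_measurable_integrable[OF f] by simp
  obtain y where y: "y \<in> borel_measurable borel" "\<And>t. y t = V f t + V y t"
    "\<And>t. norm (y t) \<le> 2 * (K * (\<integral>u. norm (f u) \<partial>lborel)) * weight t"
    by (rule Volterra_equation_solvable[OF _ V_norm_le_weight[OF f]]) auto
  have "integrable lborel y" by (rule integrable_if_le_weight[OF y(1,3)])
  then have "V (\<lambda>u. f u + y u) t = V f t + V y t" for t
    using V_lincomb[OF f, of y 1 1] by simp
  with y show thesis by (intro that) auto
qed

text \<open>No weighted bound is known for \<open>f\<close>, but \<open>V f\<close> has one and is
  again a fixed point. Iterating leaves \<open>V f\<close> unchanged while halving its bound each
  time, so \<open>V f\<close> vanishes.\<close>

lemma Volterra_fixed_point_zero: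
  assumes f: "integrable lborel f" and fix_f: "AE t in lborel. f t = V f t"
  shows "AE t in lborel. f t = 0"
proof -
  have [measurable]: "f \<in> borel_measurable borel" using borel_measurable_integrable[OF f] by simp
  define g where "g = V f"
  have [measurable]: "g \<in> borel_measurable borel" by (simp add: g_def)
  \<comment> \<open>\<open>V\<close> ignores null sets, so the almost everywhere equation for
    \<open>f\<close> becomes an equality at every point for \<open>V f\<close>.\<close>
  have "V g = g"
    using fix_f by (intro ext) (auto simp: g_def intro!: V_cong_AE[symmetric])
  then have pow: "(V ^^ n) g = g" for n by (induction n) auto
  let ?G = "K * (\<integral>u. norm (f u) \<partial>lborel)"
  have g0: "g t = 0" for t
  proof -
    have "norm (g t) \<le> ?G / 2 ^ n * weight t" for n
      using V_iterate[of g ?G n] V_norm_le_weight[OF f] by (simp add: pow g_def[symmetric])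
    moreover have "(\<lambda>n. ?G / 2 ^ n * weight t) \<longlonglongrightarrow> 0 * weight t"
      by (intro tendsto_mult tendsto_const LIMSEQ_divide_realpow_zero) simp
    ultimately have "norm (g t) \<le> 0 * weight t"
      by (intro LIMSEQ_le_const[of "\<lambda>n. ?G / 2 ^ n * weight t"]) auto
    then show ?thesis by simp
  qed
  from fix_f show ?thesis by eventually_elim (simp add: g0[unfolded g_def])
qed

text \<open>For each \<open>t\<close> the entries of \<open>k t\<close> are admissible test
  functions, and the weakly convergent subsequence does not depend on the test function; hence one
  \<open>r\<close> works for every \<open>t\<close>, without an exceptional set.\<close>

lemma V_convergent_subsequence:
  assumes x: "\<And>n. x n \<in> L2_fun lborel" and supp: "\<And>n u. u \<notin> {c..d} \<Longrightarrow> x n u = 0"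
    and bnd: "\<And>n. (\<integral>u. (norm (x n u))\<^sup>2 \<partial>lborel) \<le> R"
  obtains r :: "nat \<Rightarrow> nat" where "strict_mono r" "\<And>t. convergent (\<lambda>n. V (x (r n)) t)"
proof -
  obtain r :: "nat \<Rightarrow> nat" where r: "strict_mono r"
    and conv: "\<And>(g :: real \<Rightarrow> real) B. g \<in> borel_measurable borel \<Longrightarrow> (\<And>u. \<bar>g u\<bar> \<le> B) \<Longrightarrow>
       convergent (\<lambda>n. \<integral>u. g u *\<^sub>R x (r n) u \<partial>lborel)"
    by (rule L2_bounded_weakly_convergent_subsequence[of x c d R]) (use x supp bnd in blast)+
  have ix: "integrable lborel (x n)" for n
    by (rule integrable_if_L2_compact_support[OF x supp])
  have "convergent (\<lambda>n. V (x (r n)) t)" for t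
  proof -
    have kij: "\<bar>k t u $ i $ j\<bar> \<le> K" for u i j
      by (rule component_le_of_matrix_vector_bound[OF k_bound])
    have [measurable]: "(\<lambda>u. k t u $ i $ j) \<in> borel_measurable borel" for i j
      by (rule borel_measurable_continuous_on[OF _ k_measurable_snd]) (intro continuous_intros)
    have ig: "integrable lborel (\<lambda>u. (k t u $ i $ j) *\<^sub>R x n u)" for i j n
    proof (rule Bochner_Integration.integrable_bound[of _ "\<lambda>u. K * norm (x n u)"])
      show "AE u in lborel. norm ((k t u $ i $ j) *\<^sub>R x n u) \<le> norm (K * norm (x n u))"
        using kij K_pos by (intro AE_I2) (simp add: abs_mult mult_right_mono)
      show "(\<lambda>u. (k t u $ i $ j) *\<^sub>R x n u) \<in> borel_measurable lborel"
        using borel_measurable_integrable[OF ix] by simp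
    qed (use ix in auto)
    have "convergent (\<lambda>n. \<integral>u. (k t u $ i $ j) *\<^sub>R x (r n) u \<partial>lborel)" for i j
      by (rule conv[OF _ kij]) measurable
    then have l: "(\<lambda>n. \<integral>u. (k t u $ i $ j) *\<^sub>R x (r n) u \<partial>lborel)
        \<longlonglongrightarrow> lim (\<lambda>n. \<integral>u. (k t u $ i $ j) *\<^sub>R x (r n) u \<partial>lborel)" (is "_ \<longlonglongrightarrow> ?l i j") for i j
      by (simp add: convergent_LIMSEQ_iff)
    \<comment> \<open>Weak convergence concerns scalar multiples of the vector \<open>x n u\<close>,
      so each entry of the kernel multiplies the full vector and the \<open>j\<close>-th component
      is taken after integrating.\<close>
    have Vi: "V (x n) t $ i = (\<Sum>j\<in>UNIV. (\<integral>u. (k t u $ i $ j) *\<^sub>R x n u \<partial>lborel) $ j)" for n i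
    proof -
      have "V (x n) t $ i = (\<integral>u. (k t u *v x n u) $ i \<partial>lborel)"
        unfolding V_def
        by (rule integral_bounded_linear[OF bounded_linear_vec_nth integrable_k_mult[OF ix], symmetric])
      also have "\<dots> = (\<integral>u. (\<Sum>j\<in>UNIV. ((k t u $ i $ j) *\<^sub>R x n u) $ j) \<partial>lborel)"
        by (simp add: matrix_vector_mult_def)
      also have "\<dots> = (\<Sum>j\<in>UNIV. \<integral>u. ((k t u $ i $ j) *\<^sub>R x n u) $ j \<partial>lborel)"
        by (rule Bochner_Integration.integral_sum)
          (rule integrable_bounded_linear[OF bounded_linear_vec_nth ig])
      also have "\<dots> = (\<Sum>j\<in>UNIV. (\<integral>u. (k t u $ i $ j) *\<^sub>R x n u \<partial>lborel) $ j)"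
        by (intro sum.cong refl integral_bounded_linear[OF bounded_linear_vec_nth ig])
      finally show ?thesis .
    qed
    have "(\<lambda>n. V (x (r n)) t) \<longlonglongrightarrow> (\<chi> i. \<Sum>j\<in>UNIV. ?l i j $ j)"
      by (rule vec_tendstoI) (simp only: Vi vec_lambda_beta, intro tendsto_sum tendsto_vec_nth l)
    then show ?thesis by (auto simp: convergent_def)
  qed
  with r show thesis by (rule that)
qed

end

subsection \<open>The renewal equation as a Volterra equation\<close>

text \<open>The real-valued case, applied to each coordinate. Solutions and \<open>C\<close> are
  Lebesgue measurable, whereas the shear of the kernel and the measurability of \<open>V f\<close>
  are handled with Borel functions.\<close>

lemma lebesgue_measurable_ex_borel:
  fixes g :: "'a::euclidean_space \<Rightarrow> 'b::euclidean_space"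
  assumes "g \<in> borel_measurable lebesgue"
  obtains g' where "g' \<in> borel_measurable borel" "AE x in lborel. g x = g' x"
proof -
  have "\<exists>G\<in>borel_measurable lborel. AE x in lborel. g x \<bullet> e = G x" for e
    using assms by (intro completion_ex_borel_measurable_real) simp
  then have "\<forall>e. \<exists>G. G \<in> borel_measurable borel \<and> (AE x in lborel. g x \<bullet> e = G x)"
    by simp blast
  from choice[OF this] obtain G where [measurable]: "\<And>e. G e \<in> borel_measurable borel"
    and G: "\<And>e. AE x in lborel. g x \<bullet> e = G e x"
    by blast
  have "AE x in lborel. \<forall>e\<in>Basis. g x \<bullet> e = G e x"
    using G by (intro AE_finite_allI) auto
  then have "AE x in lborel. g x = (\<Sum>e\<in>Basis. G e x *\<^sub>R e)"
    by eventually_elim (metis (no_types, lifting) euclidean_representation sum.cong)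
  then show thesis by (intro that[of "\<lambda>x. \<Sum>e\<in>Basis. G e x *\<^sub>R e"]) auto
qed

text \<open>Both sides are compared through \<open>lebesgue\<close>: restriction to \<open>S\<close>
  amounts to multiplication by its indicator, and completion changes neither the integrability nor
  the integral of a Borel function.\<close>

lemma lebesgue_on_eq_lborel:
  fixes f f' :: "'a::euclidean_space \<Rightarrow> 'b::euclidean_space"
  assumes S: "S \<in> sets borel" and f': "f' \<in> borel_measurable borel"
    and supp: "\<And>u. u \<notin> S \<Longrightarrow> f' u = 0" and eq: "AE u in lborel. u \<in> S \<longrightarrow> f u = f' u"
  shows "f \<in> borel_measurable (lebesgue_on S)"
    and "integrable (lebesgue_on S) f \<longleftrightarrow> integrable lborel f'"
    and "integral\<^sup>L (lebesgue_on S) f = integral\<^sup>L lborel f'"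
proof -
  have S': "S \<inter> space lebesgue \<in> sets lebesgue" using S by simp
  have ae: "AE u in lebesgue. f' u = indicator S u *\<^sub>R f u"
    using AE_completion[OF eq] by eventually_elim (use supp in \<open>auto simp: indicator_def\<close>)
  have m': "f' \<in> borel_measurable lebesgue" using f' by (simp add: measurable_completion)
  then have m: "(\<lambda>u. indicator S u *\<^sub>R f u) \<in> borel_measurable lebesgue"
    using ae by (rule borel_measurable_AE)
  then show "f \<in> borel_measurable (lebesgue_on S)"
    by (simp add: borel_measurable_restrict_space_iff[OF S'])
  have "integrable (lebesgue_on S) f \<longleftrightarrow> integrable lebesgue (\<lambda>u. indicator S u *\<^sub>R f u)"
    by (rule integrable_restrict_space[OF S'])
  also have "\<dots> \<longleftrightarrow> integrable lebesgue f'"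
    by (rule integrable_cong_AE[OF m m']) (use ae in eventually_elim, simp)
  also have "\<dots> \<longleftrightarrow> integrable lborel f'" using f' by (intro integrable_completion) simp
  finally show "integrable (lebesgue_on S) f \<longleftrightarrow> integrable lborel f'" .
  have "integral\<^sup>L (lebesgue_on S) f = integral\<^sup>L lebesgue (\<lambda>u. indicator S u *\<^sub>R f u)"
    by (rule integral_restrict_space[OF S'])
  also have "\<dots> = integral\<^sup>L lebesgue f'"
    by (rule integral_cong_AE[OF m m']) (use ae in eventually_elim, simp)
  also have "\<dots> = integral\<^sup>L lborel f'" using f' by (intro integral_completion) simp
  finally show "integral\<^sup>L (lebesgue_on S) f = integral\<^sup>L lborel f'" .
qed

lemma AE_lebesgue_on_iff:
  fixes S :: "'a::euclidean_space set"
  assumes "S \<in> sets borel"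
  shows "(AE u in lebesgue_on S. P u) \<longleftrightarrow> (AE u in lborel. u \<in> S \<longrightarrow> P u)"
  using assms by (simp add: AE_restrict_space_iff AE_completion_iff)

lemma L2_fun_lebesgue_on_if_AE_eq:
  fixes x X :: "'a::euclidean_space \<Rightarrow> 'b::euclidean_space"
  assumes S: "S \<in> sets borel" and X: "X \<in> L2_fun lborel" and supp: "\<And>u. u \<notin> S \<Longrightarrow> X u = 0"
    and eq: "AE u in lborel. u \<in> S \<longrightarrow> x u = X u"
  shows "x \<in> L2_fun (lebesgue_on S)"
    and "(\<integral>u. (norm (x u))\<^sup>2 \<partial>lebesgue_on S) = (\<integral>u. (norm (X u))\<^sup>2 \<partial>lborel)"
proof -
  have Xm[measurable]: "X \<in> borel_measurable borel" and Xi: "integrable lborel (\<lambda>u. (norm (X u))\<^sup>2)"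
    using X by (auto simp: L2_fun_def)
  have sq: "AE u in lborel. u \<in> S \<longrightarrow> (norm (x u))\<^sup>2 = (norm (X u))\<^sup>2"
    using eq by eventually_elim simp
  have "(\<lambda>u. (norm (X u))\<^sup>2) \<in> borel_measurable borel" by measurable
  note sq' = lebesgue_on_eq_lborel[OF S this _ sq]
  show "x \<in> L2_fun (lebesgue_on S)"
    using lebesgue_on_eq_lborel(1)[OF S Xm supp eq] sq'(2) Xi supp by (simp add: L2_fun_def)
  show "(\<integral>u. (norm (x u))\<^sup>2 \<partial>lebesgue_on S) = (\<integral>u. (norm (X u))\<^sup>2 \<partial>lborel)"
    using supp by (intro sq'(3)) simp
qed

lemma L2_fun_lebesgue_on_ex_lborel:
  fixes x :: "'a::euclidean_space \<Rightarrow> 'b::euclidean_space"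
  assumes S: "S \<in> sets borel" and x: "x \<in> L2_fun (lebesgue_on S)"
  obtains X where "X \<in> L2_fun lborel" "\<And>u. u \<notin> S \<Longrightarrow> X u = 0"
    "AE u in lborel. u \<in> S \<longrightarrow> x u = X u"
proof -
  have "(\<lambda>u. indicator S u *\<^sub>R x u) \<in> borel_measurable lebesgue"
    using x S by (simp add: L2_fun_def borel_measurable_restrict_space_iff)
  then obtain Y where Y[measurable]: "Y \<in> borel_measurable borel"
    and ae: "AE u in lborel. indicator S u *\<^sub>R x u = Y u"
    by (rule lebesgue_measurable_ex_borel)
  define X where "X u = indicator S u *\<^sub>R Y u" for u
  have Xm[measurable]: "X \<in> borel_measurable borel" unfolding X_def using S by measurable
  have supp: "X u = 0" if "u \<notin> S" for u using that by (simp add: X_def)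
  have eq: "AE u in lborel. u \<in> S \<longrightarrow> x u = X u"
    using ae by eventually_elim (auto simp: X_def)
  have "AE u in lborel. u \<in> S \<longrightarrow> (norm (x u))\<^sup>2 = (norm (X u))\<^sup>2"
    using eq by eventually_elim simp
  then have "integrable lborel (\<lambda>u. (norm (X u))\<^sup>2)"
    using lebesgue_on_eq_lborel(2)[OF S, of "\<lambda>u. (norm (X u))\<^sup>2" "\<lambda>u. (norm (x u))\<^sup>2"] x supp
    by (simp add: L2_fun_def)
  then have "X \<in> L2_fun lborel" using Xm by (simp add: L2_fun_def)
  then show thesis using supp eq by (rule that)
qed

text \<open>\<open>P\<close> may be non-measurable, so translation is applied to a Borel null set
  containing the exceptions.\<close>

lemma AE_lborel_shift:
  fixes t :: real
  assumes "AE u in lborel. P u"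
  shows "AE u in lborel. P (t + u)"
proof -
  obtain N where N: "{u. \<not> P u} \<subseteq> N" "N \<in> null_sets lborel"
    using assms by (auto elim!: AE_E simp: null_sets_def)
  have [measurable]: "N \<in> sets borel" using N by auto
  have "AE u in lborel. u \<notin> N" by (rule AE_not_in[OF N(2)])
  then have "AE u in lborel. t + 1 * u \<notin> N"
    by (intro AE_borel_affine[where P = "\<lambda>u. u \<notin> N"]) auto
  then show ?thesis by eventually_elim (use N in auto)
qed

lemma L2_fun_lborel_shift:
  fixes X :: "real \<Rightarrow> 'b::euclidean_space"
  assumes "X \<in> L2_fun lborel"
  shows "(\<lambda>u. X (t + u)) \<in> L2_fun lborel"
    and "(\<integral>u. (norm (X (t + u)))\<^sup>2 \<partial>lborel) = (\<integral>u. (norm (X u))\<^sup>2 \<partial>lborel)"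
proof -
  have [measurable]: "X \<in> borel_measurable borel" and i: "integrable lborel (\<lambda>u. (norm (X u))\<^sup>2)"
    using assms by (auto simp: L2_fun_def)
  show "(\<lambda>u. X (t + u)) \<in> L2_fun lborel"
    using lborel_integrable_real_affine[OF i, of 1 t] by (simp add: L2_fun_def)
  show "(\<integral>u. (norm (X (t + u)))\<^sup>2 \<partial>lborel) = (\<integral>u. (norm (X u))\<^sup>2 \<partial>lborel)"
    using lborel_integral_real_affine[of 1 "\<lambda>u. (norm (X u))\<^sup>2" t] by simp
qed

lemma L2_fun_lborel_indicator:
  fixes X :: "real \<Rightarrow> 'b::euclidean_space"
  assumes X: "X \<in> L2_fun lborel" and [measurable]: "A \<in> sets borel"
  shows "(\<lambda>u. indicator A u *\<^sub>R X u) \<in> L2_fun lborel"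
    and "(\<integral>u. (norm (indicator A u *\<^sub>R X u))\<^sup>2 \<partial>lborel) \<le> (\<integral>u. (norm (X u))\<^sup>2 \<partial>lborel)"
proof -
  have [measurable]: "X \<in> borel_measurable borel" and i: "integrable lborel (\<lambda>u. (norm (X u))\<^sup>2)"
    using X by (auto simp: L2_fun_def)
  have i': "integrable lborel (\<lambda>u. (norm (indicator A u *\<^sub>R X u))\<^sup>2)"
    by (rule Bochner_Integration.integrable_bound[OF i]) (auto split: split_indicator)
  then show "(\<lambda>u. indicator A u *\<^sub>R X u) \<in> L2_fun lborel" by (simp add: L2_fun_def)
  show "(\<integral>u. (norm (indicator A u *\<^sub>R X u))\<^sup>2 \<partial>lborel) \<le> (\<integral>u. (norm (X u))\<^sup>2 \<partial>lborel)"
    by (rule integral_mono[OF i' i]) (auto split: split_indicator)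
qed

text \<open>The change of variables \<open>u = t + \<theta>\<close> turns the delay kernel \<open>C t \<theta>\<close> into the Volterra
  kernel \<open>k t u\<close>.\<close>

locale renewal_kernel = volterra_kernel k s "s + h" K
  for k :: "real \<Rightarrow> real \<Rightarrow> real^'n^'n" and s h K +
  fixes \<tau> :: real and C :: "real \<Rightarrow> real \<Rightarrow> real^'n^'n"
  assumes tau_pos: "0 < \<tau>" and tau_le: "\<tau> \<le> h"
    and k_delay: "u - t \<notin> {-\<tau>..0} \<Longrightarrow> k t u = 0"
    and k_eq_C: "AE t in lborel. t \<in> {s..s + h} \<longrightarrow>
      (AE \<theta> in lborel. \<theta> \<in> {-\<tau>..0} \<longrightarrow> C t \<theta> = k t (t + \<theta>))"

text \<open>\<open>C\<close> comes with an essential bound only. A Borel version, set to zero off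
  the rectangle and wherever it exceeds the bound, is bounded everywhere; the shear
  \<open>u = t + \<theta>\<close> turns it into \<open>k\<close>.\<close>

lemma renewal_kernel_exists:
  fixes C :: "real \<Rightarrow> real \<Rightarrow> real^'n^'n"
  assumes "0 < \<tau>" "\<tau> \<le> h"
    and C: "(\<lambda>(t, \<theta>). C t \<theta>) \<in> Linf_fun (lebesgue_on ({s..s + h} \<times> {-\<tau>..0}))"
  obtains k K where "renewal_kernel k s h K \<tau> C"
proof -
  let ?S = "{s..s + h} \<times> {-\<tau>..0}"
  have S: "?S \<in> sets borel" by (intro borel_closed closed_Times) auto
  have S': "?S \<inter> space lebesgue \<in> sets lebesgue" using S by simp
  obtain B where Cm: "(\<lambda>(t, \<theta>). C t \<theta>) \<in> borel_measurable (lebesgue_on ?S)"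
    and B: "AE p in lebesgue_on ?S. norm (case p of (t, \<theta>) \<Rightarrow> C t \<theta>) \<le> B"
    using C by (auto simp: Linf_fun_def)
  have "(\<lambda>p. indicator ?S p *\<^sub>R (case p of (t, \<theta>) \<Rightarrow> C t \<theta>)) \<in> borel_measurable lebesgue"
    using Cm by (simp add: borel_measurable_restrict_space_iff[OF S'])
  then obtain D where D[measurable]: "D \<in> borel_measurable borel"
    and CD: "AE p in lborel. indicator ?S p *\<^sub>R (case p of (t, \<theta>) \<Rightarrow> C t \<theta>) = D p"
    by (rule lebesgue_measurable_ex_borel)
  define E where "E p = (if p \<in> ?S \<and> norm (D p) \<le> B then D p else 0)" for p
  have [measurable]: "E \<in> borel_measurable borel"
    unfolding E_def using S by measurable
  define k where "k t u = E (t, u - t)" for t u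
  \<comment> \<open>Entries bounded by \<open>\<bar>B\<bar>\<close> bound the operator norm by
    \<open>\<bar>B\<bar>\<close> times the number of entries; the \<open>+ 1\<close> keeps
    \<open>K\<close> positive when \<open>B = 0\<close>.\<close>
  define K where "K = real (CARD('n)) * real (CARD('n)) * \<bar>B\<bar> + 1"
  have "renewal_kernel k s h K \<tau> C"
  proof
    show "(\<lambda>(t, u). k t u) \<in> borel_measurable (borel \<Otimes>\<^sub>M borel)"
    proof -
      have "(\<lambda>p. (fst p, snd p - fst p)) \<in> borel_measurable (borel \<Otimes>\<^sub>M borel :: (real \<times> real) measure)"
        by (intro borel_measurable_Pair borel_measurable_diff measurable_fst measurable_snd)
      from measurable_compose[OF this \<open>E \<in> borel_measurable borel\<close>]
      show ?thesis by (simp add: k_def case_prod_beta)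
    qed
    show "0 < K" by (simp add: K_def add_nonneg_pos)
    show "norm (k t u *v v) \<le> K * norm v" for t u v
    proof -
      have "norm (k t u) \<le> \<bar>B\<bar>" by (auto simp: k_def E_def)
      then have "\<bar>k t u $ i $ j\<bar> \<le> \<bar>B\<bar>" for i j
        using Finite_Cartesian_Product.norm_nth_le[of "k t u" i]
          Finite_Cartesian_Product.norm_nth_le[of "k t u $ i" j] by simp
      then have "onorm ((*v) (k t u)) \<le> real (CARD('n)) * real (CARD('n)) * \<bar>B\<bar>"
        by (intro onorm_le_matrix_component) auto
      then have "onorm ((*v) (k t u)) \<le> K" by (simp add: K_def)
      then have "onorm ((*v) (k t u)) * norm v \<le> K * norm v" by (intro mult_right_mono) auto
      then show ?thesis using onorm[OF matrix_vector_mul_bounded_linear, of "k t u" v] by linarith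
    qed
    show "s \<le> t \<and> t \<le> s + h \<and> u \<le> t" if "k t u \<noteq> 0" for t u
      using that by (auto simp: k_def E_def split: if_splits)
    show "k t u = 0" if "u - t \<notin> {-\<tau>..0}" for t u
      using that by (auto simp: k_def E_def)
    have "AE p in lborel. p \<in> ?S \<longrightarrow> norm (case p of (t, \<theta>) \<Rightarrow> C t \<theta>) \<le> B"
      using B by (simp add: AE_lebesgue_on_iff[OF S])
    with CD have "AE p in lborel. p \<in> ?S \<longrightarrow> (case p of (t, \<theta>) \<Rightarrow> C t \<theta>) = E p"
      by eventually_elim (auto simp: E_def)
    then have "AE p in (lborel \<Otimes>\<^sub>M lborel). p \<in> ?S \<longrightarrow> (case p of (t, \<theta>) \<Rightarrow> C t \<theta>) = E p"
      unfolding lborel_prod .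
    \<comment> \<open>Fubini: a null set of the plane has null sections for almost every
      \<open>t\<close>.\<close>
    from lborel_pair.AE_pair[OF this]
    show "AE t in lborel. t \<in> {s..s + h} \<longrightarrow>
      (AE \<theta> in lborel. \<theta> \<in> {-\<tau>..0} \<longrightarrow> C t \<theta> = k t (t + \<theta>))"
      by eventually_elim (auto simp: k_def)
  qed (use assms in auto)
  then show thesis by (rule that)
qed

section \<open>Solutions of the renewal equation: linearity, uniqueness, existence with a
  bound\<close>

context renewal_kernel
begin

text \<open>For \<open>t\<close> in \<open>{s..s + h}\<close> the argument
  \<open>t + \<theta>\<close> stays in \<open>{s - \<tau>..s + h}\<close>, where \<open>x\<close>
  and \<open>X\<close> agree almost everywhere; the rest is translation invariance.\<close>

lemma delay_integral_eq_V:
  assumes X[measurable]: "X \<in> borel_measurable borel"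
    and eq: "AE u in lborel. u \<in> {s - \<tau>..s + h} \<longrightarrow> x u = X u"
  shows "AE t in lborel. t \<in> {s..s + h} \<longrightarrow>
    (\<integral>\<theta>. C t \<theta> *v x (t + \<theta>) \<partial>lebesgue_on {-\<tau>..0}) = V X t"
  using k_eq_C
proof eventually_elim
  case (elim t)
  show ?case
  proof
    assume t: "t \<in> {s..s + h}"
    have "(\<integral>\<theta>. C t \<theta> *v x (t + \<theta>) \<partial>lebesgue_on {-\<tau>..0}) = (\<integral>\<theta>. k t (t + \<theta>) *v X (t + \<theta>) \<partial>lborel)"
    proof (rule lebesgue_on_eq_lborel(3))
      show "(\<lambda>\<theta>. k t (t + \<theta>) *v X (t + \<theta>)) \<in> borel_measurable borel" by measurable
      show "k t (t + \<theta>) *v X (t + \<theta>) = 0" if "\<theta> \<notin> {-\<tau>..0}" for \<theta>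
        using k_delay[of "t + \<theta>" t] that by (simp add: matrix_vector_mult_0)
      have "AE \<theta> in lborel. \<theta> \<in> {-\<tau>..0} \<longrightarrow> C t \<theta> = k t (t + \<theta>)" using elim t by simp
      with AE_lborel_shift[OF eq, of t]
      show "AE \<theta> in lborel. \<theta> \<in> {-\<tau>..0} \<longrightarrow> C t \<theta> *v x (t + \<theta>) = k t (t + \<theta>) *v X (t + \<theta>)"
        by eventually_elim (use t in auto)
    qed auto
    also have "\<dots> = V X t"
      unfolding V_def using lborel_integral_real_affine[of 1 "\<lambda>u. k t u *v X u" t] by simp
    finally show "(\<integral>\<theta>. C t \<theta> *v x (t + \<theta>) \<partial>lebesgue_on {-\<tau>..0}) = V X t" .
  qed
qed

text \<open>Trades \<open>x\<close> for a Borel function on which \<open>V\<close> acts; all clauses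
  of the definition are insensitive to null sets.\<close>

lemma renewal_solution_iff:
  assumes X: "X \<in> L2_fun lborel" and supp: "\<And>u. u \<notin> {s - \<tau>..s + h} \<Longrightarrow> X u = 0"
    and eq: "AE u in lborel. u \<in> {s - \<tau>..s + h} \<longrightarrow> x u = X u"
  shows "renewal_solution \<tau> h C s \<phi> x \<longleftrightarrow>
    (AE t in lborel. t \<in> {s..s + h} \<longrightarrow> X t = V X t) \<and>
    (AE \<theta> in lborel. \<theta> \<in> {-\<tau>..0} \<longrightarrow> X (s + \<theta>) = \<phi> \<theta>)"
proof -
  have Xm: "X \<in> borel_measurable borel" using X by (simp add: L2_fun_def)
  have "x \<in> L2_fun (lebesgue_on {s - \<tau>..s + h})"
    by (rule L2_fun_lebesgue_on_if_AE_eq[OF _ X supp eq]) simp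
  moreover have "(AE t in lborel. t \<in> {s..s + h} \<longrightarrow>
      x t = (\<integral>\<theta>. C t \<theta> *v x (t + \<theta>) \<partial>lebesgue_on {-\<tau>..0})) \<longleftrightarrow>
    (AE t in lborel. t \<in> {s..s + h} \<longrightarrow> X t = V X t)"
    (is "(AE t in lborel. ?P t) \<longleftrightarrow> (AE t in lborel. ?Q t)")
  proof -
    have "AE t in lborel. ?P t \<longleftrightarrow> ?Q t"
      using delay_integral_eq_V[OF Xm eq] eq by eventually_elim (use tau_pos in auto)
    then show ?thesis by (auto elim: AE_mp)
  qed
  moreover have "(AE \<theta> in lborel. \<theta> \<in> {-\<tau>..0} \<longrightarrow> x (s + \<theta>) = \<phi> \<theta>) \<longleftrightarrow>
    (AE \<theta> in lborel. \<theta> \<in> {-\<tau>..0} \<longrightarrow> X (s + \<theta>) = \<phi> \<theta>)"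
    (is "(AE t in lborel. ?P t) \<longleftrightarrow> (AE t in lborel. ?Q t)")
  proof -
    have "AE t in lborel. ?P t \<longleftrightarrow> ?Q t"
      using AE_lborel_shift[OF eq, of s] by eventually_elim (use tau_pos tau_le in auto)
    then show ?thesis by (auto elim: AE_mp)
  qed
  ultimately show ?thesis
    by (simp add: renewal_solution_def AE_lebesgue_on_iff)
qed

lemma renewal_solution_obtain:
  assumes "renewal_solution \<tau> h C s \<phi> x"
  obtains X where "X \<in> L2_fun lborel" "\<And>u. u \<notin> {s - \<tau>..s + h} \<Longrightarrow> X u = 0"
    "AE u in lborel. u \<in> {s - \<tau>..s + h} \<longrightarrow> x u = X u"
    "AE t in lborel. t \<in> {s..s + h} \<longrightarrow> X t = V X t"
    "AE \<theta> in lborel. \<theta> \<in> {-\<tau>..0} \<longrightarrow> X (s + \<theta>) = \<phi> \<theta>"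
proof -
  have "x \<in> L2_fun (lebesgue_on {s - \<tau>..s + h})"
    using assms by (simp add: renewal_solution_def)
  then obtain X where X: "X \<in> L2_fun lborel" "\<And>u. u \<notin> {s - \<tau>..s + h} \<Longrightarrow> X u = 0"
    "AE u in lborel. u \<in> {s - \<tau>..s + h} \<longrightarrow> x u = X u"
    by (rule L2_fun_lebesgue_on_ex_lborel[rotated]) auto
  then show thesis using assms renewal_solution_iff[OF X] by (intro that) auto
qed

lemma renewal_solution_lincomb:
  assumes "renewal_solution \<tau> h C s \<phi> x" "renewal_solution \<tau> h C s \<psi> y"
  shows "renewal_solution \<tau> h C s (\<lambda>\<theta>. p *\<^sub>R \<phi> \<theta> + q *\<^sub>R \<psi> \<theta>) (\<lambda>u. p *\<^sub>R x u + q *\<^sub>R y u)"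
proof -
  obtain X where X: "X \<in> L2_fun lborel" "\<And>u. u \<notin> {s - \<tau>..s + h} \<Longrightarrow> X u = 0"
    "AE u in lborel. u \<in> {s - \<tau>..s + h} \<longrightarrow> x u = X u"
    "AE t in lborel. t \<in> {s..s + h} \<longrightarrow> X t = V X t"
    "AE \<theta> in lborel. \<theta> \<in> {-\<tau>..0} \<longrightarrow> X (s + \<theta>) = \<phi> \<theta>"
    using renewal_solution_obtain[OF assms(1)] by blast
  obtain Y where Y: "Y \<in> L2_fun lborel" "\<And>u. u \<notin> {s - \<tau>..s + h} \<Longrightarrow> Y u = 0"
    "AE u in lborel. u \<in> {s - \<tau>..s + h} \<longrightarrow> y u = Y u"
    "AE t in lborel. t \<in> {s..s + h} \<longrightarrow> Y t = V Y t"
    "AE \<theta> in lborel. \<theta> \<in> {-\<tau>..0} \<longrightarrow> Y (s + \<theta>) = \<psi> \<theta>"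
    using renewal_solution_obtain[OF assms(2)] by blast
  have "AE u in lborel. u \<in> {s - \<tau>..s + h} \<longrightarrow> p *\<^sub>R x u + q *\<^sub>R y u = p *\<^sub>R X u + q *\<^sub>R Y u"
    using X(3) Y(3) by eventually_elim auto
  note iff = renewal_solution_iff[OF L2_fun_lincomb[OF X(1) Y(1), of p q] _ this]
  have V: "V (\<lambda>u. p *\<^sub>R X u + q *\<^sub>R Y u) t = p *\<^sub>R V X t + q *\<^sub>R V Y t" for t
    by (intro V_lincomb integrable_if_L2_compact_support[OF X(1,2)] integrable_if_L2_compact_support[OF Y(1,2)])
  show ?thesis
  proof (subst iff)
    show "(AE t in lborel. t \<in> {s..s + h} \<longrightarrow>
        p *\<^sub>R X t + q *\<^sub>R Y t = V (\<lambda>u. p *\<^sub>R X u + q *\<^sub>R Y u) t) \<and>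
      (AE \<theta> in lborel. \<theta> \<in> {-\<tau>..0} \<longrightarrow>
        p *\<^sub>R X (s + \<theta>) + q *\<^sub>R Y (s + \<theta>) = p *\<^sub>R \<phi> \<theta> + q *\<^sub>R \<psi> \<theta>)"
    proof
      show "AE t in lborel. t \<in> {s..s + h} \<longrightarrow>
        p *\<^sub>R X t + q *\<^sub>R Y t = V (\<lambda>u. p *\<^sub>R X u + q *\<^sub>R Y u) t"
        using X(4) Y(4) by eventually_elim (simp add: V)
      show "AE \<theta> in lborel. \<theta> \<in> {-\<tau>..0} \<longrightarrow>
        p *\<^sub>R X (s + \<theta>) + q *\<^sub>R Y (s + \<theta>) = p *\<^sub>R \<phi> \<theta> + q *\<^sub>R \<psi> \<theta>"
        using X(5) Y(5) by eventually_elim simp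
    qed
  qed (use X(2) Y(2) in simp)
qed

text \<open>The difference of two solutions has zero history, so it is a fixed point of
  \<open>V\<close> almost everywhere on the whole line: outside \<open>{s..s + h}\<close> both it
  and its image vanish.\<close>

lemma renewal_solution_unique:
  assumes "renewal_solution \<tau> h C s \<phi> x" "renewal_solution \<tau> h C s \<psi> y"
    and ae: "AE \<theta> in lborel. \<theta> \<in> {-\<tau>..0} \<longrightarrow> \<phi> \<theta> = \<psi> \<theta>"
  shows "AE u in lborel. u \<in> {s - \<tau>..s + h} \<longrightarrow> x u = y u"
proof -
  obtain X where X: "X \<in> L2_fun lborel" "\<And>u. u \<notin> {s - \<tau>..s + h} \<Longrightarrow> X u = 0"
    "AE u in lborel. u \<in> {s - \<tau>..s + h} \<longrightarrow> 1 *\<^sub>R x u + (- 1) *\<^sub>R y u = X u"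
    "AE t in lborel. t \<in> {s..s + h} \<longrightarrow> X t = V X t"
    "AE \<theta> in lborel. \<theta> \<in> {-\<tau>..0} \<longrightarrow> X (s + \<theta>) = 1 *\<^sub>R \<phi> \<theta> + (- 1) *\<^sub>R \<psi> \<theta>"
    using renewal_solution_obtain[OF renewal_solution_lincomb[OF assms(1,2), of 1 "- 1"]] by blast
  have "AE \<theta> in lborel. \<theta> \<in> {-\<tau>..0} \<longrightarrow> X (s + \<theta>) = 0"
    using X(5) ae by eventually_elim simp
  from AE_lborel_shift[OF this, of "- s"]
  have "AE u in lborel. u - s \<in> {-\<tau>..0} \<longrightarrow> X u = 0" by simp
  with X(4) have "AE t in lborel. X t = V X t"
  proof eventually_elim
    case (elim t)
    show ?case
    proof (cases "t \<in> {s..s + h}")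
      case False
      then have "X t = 0" using elim X(2)[of t] by force
      then show ?thesis using V_outside[OF False] by simp
    qed (use elim in simp)
  qed
  moreover have "integrable lborel X" by (rule integrable_if_L2_compact_support[OF X(1,2)])
  ultimately have "AE t in lborel. X t = 0" by (intro Volterra_fixed_point_zero)
  with X(3) show ?thesis by eventually_elim simp
qed

text \<open>History plus Volterra continuation. \<open>R\<close> is quantified before
  \<open>\<phi>\<close> because compactness needs one bound for a whole bounded set of initial
  functions.\<close>

lemma renewal_solution_exists:
  "\<exists>R. \<forall>\<phi>\<in>L2_fun (lebesgue_on {-\<tau>..0}).
    (\<integral>\<theta>. (norm (\<phi> \<theta>))\<^sup>2 \<partial>lebesgue_on {-\<tau>..0}) \<le> P \<longrightarrow>
    (\<exists>X. X \<in> L2_fun lborel \<and> (\<forall>u. u \<notin> {s - \<tau>..s + h} \<longrightarrow> X u = 0) \<and>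
      (\<forall>t\<ge>s. X t = V X t) \<and> renewal_solution \<tau> h C s \<phi> X \<and>
      (\<integral>u. (norm (X u))\<^sup>2 \<partial>lborel) \<le> R)"
proof -
  \<comment> \<open>\<open>(P + \<tau>) / 2\<close> bounds the L1 norm of the history, the
    continuation is bounded by twice \<open>K\<close> times that norm, and
    \<open>exp (2 * K * h)\<close> bounds the weight.\<close>
  define Q where "Q = K * (P + \<tau>) * exp (2 * K * h)"
  show ?thesis
  proof (intro exI[of _ "P + Q\<^sup>2 * h"] ballI impI)
    fix \<phi> :: "real \<Rightarrow> real^'n"
    assume \<phi>: "\<phi> \<in> L2_fun (lebesgue_on {-\<tau>..0})"
      and P: "(\<integral>\<theta>. (norm (\<phi> \<theta>))\<^sup>2 \<partial>lebesgue_on {-\<tau>..0}) \<le> P"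
    obtain \<Phi> where \<Phi>: "\<Phi> \<in> L2_fun lborel" "\<And>u. u \<notin> {-\<tau>..0} \<Longrightarrow> \<Phi> u = 0"
      "AE u in lborel. u \<in> {-\<tau>..0} \<longrightarrow> \<phi> u = \<Phi> u"
      by (rule L2_fun_lebesgue_on_ex_lborel[OF _ \<phi>]) auto
    have \<Phi>P: "(\<integral>u. (norm (\<Phi> u))\<^sup>2 \<partial>lborel) \<le> P"
      using L2_fun_lebesgue_on_if_AE_eq(2)[OF _ \<Phi>] P by simp
    \<comment> \<open>The endpoint \<open>s\<close> is left out of the history, so that at
      \<open>t = s\<close> the equation and not \<open>\<phi>\<close> determines the value.\<close>
    define f where "f u = indicator {..<s} u *\<^sub>R \<Phi> (- s + u)" for u
    have f: "f \<in> L2_fun lborel"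
      unfolding f_def by (intro L2_fun_lborel_indicator(1) L2_fun_lborel_shift(1) \<Phi>) simp
    have fP: "(\<integral>u. (norm (f u))\<^sup>2 \<partial>lborel) \<le> P"
      using L2_fun_lborel_indicator(2)[OF L2_fun_lborel_shift(1)[OF \<Phi>(1), of "- s"], of "{..<s}"]
        L2_fun_lborel_shift(2)[OF \<Phi>(1), of "- s"] \<Phi>P by (simp add: f_def)
    have f0: "f u = 0" if "u \<notin> {s - \<tau>..s}" for u
      using \<Phi>(2)[of "- s + u"] that by (auto simp: f_def indicator_def)
    have fi: "integrable lborel f" by (rule integrable_if_L2_compact_support[OF f f0])
    have f1: "(\<integral>u. norm (f u) \<partial>lborel) \<le> (P + \<tau>) / 2"
    proof -
      have "(\<integral>u. indicator UNIV u * norm (f u) \<partial>lborel)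
          \<le> (1 * (\<integral>u. (norm (f u))\<^sup>2 \<partial>lborel) + measure lborel (UNIV \<inter> {s - \<tau>..s}) / 1) / 2"
        by (rule norm_set_integral_le_AM_GM[OF f f0]) auto
      then show ?thesis using fP tau_pos by simp
    qed
    obtain y where ym[measurable]: "y \<in> borel_measurable borel"
      and y: "\<And>t. y t = V (\<lambda>u. f u + y u) t"
      and yle: "\<And>t. norm (y t) \<le> 2 * (K * (\<integral>u. norm (f u) \<partial>lborel)) * weight t"
      by (rule Volterra_continuation[OF fi]) blast
    have yQ: "norm (y t) \<le> Q * indicator {s..s + h} t" for t
    proof -
      have "2 * (K * (\<integral>u. norm (f u) \<partial>lborel)) \<le> K * (P + \<tau>)"
        using mult_left_mono[OF f1 less_imp_le[OF K_pos]] by simp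
      moreover have "0 \<le> 2 * (K * (\<integral>u. norm (f u) \<partial>lborel))" using K_pos by simp
      moreover have "weight t \<le> exp (2 * K * h) * indicator {s..s + h} t"
        using weight_le[of t] by simp
      ultimately have "2 * (K * (\<integral>u. norm (f u) \<partial>lborel)) * weight t
          \<le> K * (P + \<tau>) * (exp (2 * K * h) * indicator {s..s + h} t)"
        using weight_nonneg[of t] by (intro mult_mono[of _ "K * (P + \<tau>)"]) linarith+
      then show ?thesis using yle[of t] by (simp add: Q_def)
    qed
    have y2: "(norm (y t))\<^sup>2 \<le> Q\<^sup>2 * indicator {s..s + h} t" for t
      using power_mono[OF yQ norm_ge_zero, of t 2] by (cases "t \<in> {s..s + h}") simp_all
    have Q2i: "integrable lborel (\<lambda>t. Q\<^sup>2 * indicator {s..s + h} t)"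
      by (intro integrable_mult_right integrable_real_indicator) (auto simp: emeasure_lborel_Icc_eq)
    have y2i: "integrable lborel (\<lambda>t. (norm (y t))\<^sup>2)"
      by (rule Bochner_Integration.integrable_bound[OF Q2i]) (use y2 in auto)
    define X where "X u = f u + y u" for u
    have XL2: "X \<in> L2_fun lborel"
      using L2_fun_lincomb[OF f, of y 1 1] y2i by (simp add: X_def[abs_def] L2_fun_def)
    have y0: "y t = 0" if "t \<notin> {s..s + h}" for t using yQ[of t] that by simp
    have X0: "X u = 0" if "u \<notin> {s - \<tau>..s + h}" for u
      using that f0[of u] y0[of u] tau_pos tau_le by (auto simp: X_def)
    have XV: "X t = V X t" if "t \<ge> s" for t
      using that y[of t] by (simp add: X_def[abs_def] f_def)
    have "renewal_solution \<tau> h C s \<phi> X"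
    proof (subst renewal_solution_iff[OF XL2 X0])
      \<comment> \<open>At \<open>\<theta> = 0\<close> the history was cut off, so \<open>X\<close>
        may differ from \<open>\<phi>\<close> there.\<close>
      have "AE \<theta> in lborel. \<theta> \<noteq> 0" by (rule AE_lborel_singleton)
      with \<Phi>(3) have "AE \<theta> in lborel. \<theta> \<in> {-\<tau>..0} \<longrightarrow> X (s + \<theta>) = \<phi> \<theta>"
        by eventually_elim (auto simp: X_def f_def y0)
      then show "(AE t in lborel. t \<in> {s..s + h} \<longrightarrow> X t = V X t) \<and>
          (AE \<theta> in lborel. \<theta> \<in> {-\<tau>..0} \<longrightarrow> X (s + \<theta>) = \<phi> \<theta>)"
        using XV by simp
    qed auto
    moreover have "(\<integral>u. (norm (X u))\<^sup>2 \<partial>lborel) \<le> P + Q\<^sup>2 * h"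
    proof -
      \<comment> \<open>\<open>f\<close> lives before \<open>s\<close> and \<open>y\<close> from
        \<open>s\<close> on, so there is no cross term.\<close>
      have "(norm (X u))\<^sup>2 = (norm (f u))\<^sup>2 + (norm (y u))\<^sup>2" for u
        using y0[of u] by (cases "u < s") (auto simp: X_def f_def)
      then have "(\<integral>u. (norm (X u))\<^sup>2 \<partial>lborel)
          = (\<integral>u. (norm (f u))\<^sup>2 \<partial>lborel) + (\<integral>u. (norm (y u))\<^sup>2 \<partial>lborel)"
        using f y2i by (simp add: L2_fun_def)
      moreover have "(\<integral>u. (norm (y u))\<^sup>2 \<partial>lborel) \<le> Q\<^sup>2 * h"
        using integral_mono[OF y2i Q2i y2] tau_pos tau_le by simp
      ultimately show ?thesis using fP by linarith
    qed
    ultimately show "\<exists>X. X \<in> L2_fun lborel \<and> (\<forall>u. u \<notin> {s - \<tau>..s + h} \<longrightarrow> X u = 0) \<and>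
        (\<forall>t\<ge>s. X t = V X t) \<and> renewal_solution \<tau> h C s \<phi> X \<and>
        (\<integral>u. (norm (X u))\<^sup>2 \<partial>lborel) \<le> P + Q\<^sup>2 * h"
      using XL2 X0 XV by blast
  qed
qed

end

subsection \<open>Compactness of the evolution operator\<close>

context renewal_kernel
begin

abbreviation seg_measure :: "real measure"
  where "seg_measure \<equiv> lebesgue_on {-\<tau>..0}"

abbreviation T :: "(real \<Rightarrow> real^'n) set \<Rightarrow> (real \<Rightarrow> real^'n) set"
  where "T \<equiv> evolution \<tau> h C (s + h) s"

lemma final_segment_L2:
  assumes "renewal_solution \<tau> h C s \<phi> x"
  shows "(\<lambda>\<theta>. x (s + h + \<theta>)) \<in> L2_fun seg_measure"
proof -
  obtain X where X: "X \<in> L2_fun lborel" "AE u in lborel. u \<in> {s - \<tau>..s + h} \<longrightarrow> x u = X u"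
    using renewal_solution_obtain[OF assms] by blast
  show ?thesis
  proof (rule L2_fun_lebesgue_on_if_AE_eq(1))
    show "(\<lambda>\<theta>. indicator {-\<tau>..0} \<theta> *\<^sub>R X (s + h + \<theta>)) \<in> L2_fun lborel"
      by (intro L2_fun_lborel_indicator(1) L2_fun_lborel_shift(1) X) simp
    show "AE \<theta> in lborel. \<theta> \<in> {-\<tau>..0} \<longrightarrow>
        x (s + h + \<theta>) = indicator {-\<tau>..0} \<theta> *\<^sub>R X (s + h + \<theta>)"
      using AE_lborel_shift[OF X(2), of "s + h"]
      by eventually_elim (use tau_pos tau_le in auto)
  qed auto
qed

text \<open>The description in \<open>evolution\<close> is well defined: another representative with
  another solution yields the same final segment almost everywhere, by uniqueness.\<close>

lemma evolution_class_eq: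
  assumes \<phi>: "\<phi> \<in> L2_fun seg_measure" and x: "renewal_solution \<tau> h C s \<phi> x"
  shows "T (L2_class seg_measure \<phi>) = L2_class seg_measure (\<lambda>\<theta>. x (s + h + \<theta>))"
  unfolding evolution_def
proof (rule the_equality)
  have "\<phi> \<in> L2_class seg_measure \<phi>" using \<phi> by (simp add: L2_class_def L2_rel_def)
  then show "\<exists>\<psi>\<in>L2_class seg_measure \<phi>. \<exists>y. renewal_solution \<tau> h C s \<psi> y \<and>
      L2_class seg_measure (\<lambda>\<theta>. x (s + h + \<theta>)) = L2_class seg_measure (\<lambda>\<theta>. y (s + h + \<theta>))"
    using x by blast
next
  fix \<Psi> assume "\<exists>\<psi>\<in>L2_class seg_measure \<phi>. \<exists>y. renewal_solution \<tau> h C s \<psi> y \<and>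
      \<Psi> = L2_class seg_measure (\<lambda>\<theta>. y (s + h + \<theta>))"
  then obtain \<psi> y where \<psi>: "\<psi> \<in> L2_class seg_measure \<phi>" and y: "renewal_solution \<tau> h C s \<psi> y"
    and \<Psi>: "\<Psi> = L2_class seg_measure (\<lambda>\<theta>. y (s + h + \<theta>))" by blast
  have "AE \<theta> in seg_measure. \<phi> \<theta> = \<psi> \<theta>" using \<psi> by (simp add: L2_class_def L2_rel_def)
  then have "AE \<theta> in lborel. \<theta> \<in> {-\<tau>..0} \<longrightarrow> \<phi> \<theta> = \<psi> \<theta>" by (simp add: AE_lebesgue_on_iff)
  from AE_lborel_shift[OF renewal_solution_unique[OF x y this], of "s + h"]
  have "AE \<theta> in lborel. \<theta> \<in> {-\<tau>..0} \<longrightarrow> y (s + h + \<theta>) = x (s + h + \<theta>)"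
    by eventually_elim (use tau_pos tau_le in auto)
  then have "AE \<theta> in seg_measure. y (s + h + \<theta>) = x (s + h + \<theta>)"
    by (simp add: AE_lebesgue_on_iff)
  then show "\<Psi> = L2_class seg_measure (\<lambda>\<theta>. x (s + h + \<theta>))"
    unfolding \<Psi> using final_segment_L2[OF x] final_segment_L2[OF y] by (simp add: L2_class_eq_iff)
qed

lemma renewal_solution_ex:
  assumes "\<phi> \<in> L2_fun seg_measure"
  obtains x where "renewal_solution \<tau> h C s \<phi> x"
  using renewal_solution_exists[of "\<integral>\<theta>. (norm (\<phi> \<theta>))\<^sup>2 \<partial>seg_measure"] assms order_refl
  by metis

lemma evolution_in_L2:
  assumes "F \<in> L2 seg_measure"
  shows "T F \<in> L2 seg_measure"
proof -
  obtain x where x: "renewal_solution \<tau> h C s (L2_rep F) x"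
    by (rule renewal_solution_ex[OF L2_rep_fun[OF assms]])
  have "T F = L2_class seg_measure (\<lambda>\<theta>. x (s + h + \<theta>))"
    using evolution_class_eq[OF L2_rep_fun[OF assms] x] by (simp add: L2_class_rep[OF assms])
  then show ?thesis by (simp add: L2_class_in[OF final_segment_L2[OF x]])
qed

lemma evolution_add:
  assumes F: "F \<in> L2 seg_measure" and G: "G \<in> L2 seg_measure"
  shows "T (L2_add seg_measure F G) = L2_add seg_measure (T F) (T G)"
proof -
  note f = L2_rep_fun[OF F] and g = L2_rep_fun[OF G]
  obtain x where x: "renewal_solution \<tau> h C s (L2_rep F) x" by (rule renewal_solution_ex[OF f])
  obtain y where y: "renewal_solution \<tau> h C s (L2_rep G) y" by (rule renewal_solution_ex[OF g])
  have "T (L2_add seg_measure F G) = L2_class seg_measure (\<lambda>\<theta>. x (s + h + \<theta>) + y (s + h + \<theta>))"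
    using evolution_class_eq[OF L2_fun_lincomb[OF f g, of 1 1] renewal_solution_lincomb[OF x y, of 1 1]]
    by (simp add: L2_add_def)
  also have "\<dots> = L2_add seg_measure (T F) (T G)"
    using evolution_class_eq[OF f x] evolution_class_eq[OF g y] F G
    by (simp add: L2_class_rep L2_add_class final_segment_L2[OF x] final_segment_L2[OF y])
  finally show ?thesis .
qed

lemma evolution_scale:
  assumes F: "F \<in> L2 seg_measure"
  shows "T (L2_scale seg_measure c F) = L2_scale seg_measure c (T F)"
proof -
  note f = L2_rep_fun[OF F]
  obtain x where x: "renewal_solution \<tau> h C s (L2_rep F) x" by (rule renewal_solution_ex[OF f])
  have "T (L2_scale seg_measure c F) = L2_class seg_measure (\<lambda>\<theta>. c *\<^sub>R x (s + h + \<theta>))"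
    using evolution_class_eq[OF L2_fun_lincomb[OF f f, of c 0] renewal_solution_lincomb[OF x x, of c 0]]
    by (simp add: L2_scale_def)
  also have "\<dots> = L2_scale seg_measure c (T F)"
    using evolution_class_eq[OF f x] F
    by (simp add: L2_class_rep L2_scale_class final_segment_L2[OF x])
  finally show ?thesis .
qed

section \<open>Sequential compactness of images of bounded sets\<close>

lemma evolution_bounded_sequence:
  assumes F: "\<And>n. F n \<in> L2 seg_measure"
    and bnd: "\<And>n. (\<integral>\<theta>. (norm (L2_rep (F n) \<theta>))\<^sup>2 \<partial>seg_measure) \<le> P"
  obtains l and r :: "nat \<Rightarrow> nat" where "l \<in> L2 seg_measure" "strict_mono r"
    "(\<lambda>n. L2_dist seg_measure (T (F (r n))) l) \<longlonglongrightarrow> 0"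
proof -
  obtain R where R: "\<forall>\<phi>\<in>L2_fun seg_measure. (\<integral>\<theta>. (norm (\<phi> \<theta>))\<^sup>2 \<partial>seg_measure) \<le> P \<longrightarrow>
    (\<exists>X. X \<in> L2_fun lborel \<and> (\<forall>u. u \<notin> {s - \<tau>..s + h} \<longrightarrow> X u = 0) \<and>
      (\<forall>t\<ge>s. X t = V X t) \<and> renewal_solution \<tau> h C s \<phi> X \<and>
      (\<integral>u. (norm (X u))\<^sup>2 \<partial>lborel) \<le> R)"
    using renewal_solution_exists by (rule exE)
  have "\<forall>n. \<exists>X. X \<in> L2_fun lborel \<and> (\<forall>u. u \<notin> {s - \<tau>..s + h} \<longrightarrow> X u = 0) \<and>
      (\<forall>t\<ge>s. X t = V X t) \<and> renewal_solution \<tau> h C s (L2_rep (F n)) X \<and>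
      (\<integral>u. (norm (X u))\<^sup>2 \<partial>lborel) \<le> R"
    using R L2_rep_fun[OF F] bnd by (intro allI) simp
  from choice[OF this] obtain X where X: "\<And>n. X n \<in> L2_fun lborel"
    and X0: "\<And>n u. u \<notin> {s - \<tau>..s + h} \<Longrightarrow> X n u = 0"
    and XV: "\<And>n t. t \<ge> s \<Longrightarrow> X n t = V (X n) t"
    and sol: "\<And>n. renewal_solution \<tau> h C s (L2_rep (F n)) (X n)"
    and XR: "\<And>n. (\<integral>u. (norm (X n u))\<^sup>2 \<partial>lborel) \<le> R"
    by blast
  obtain r :: "nat \<Rightarrow> nat" where r: "strict_mono r" and conv: "\<And>t. convergent (\<lambda>n. V (X (r n)) t)"
    by (rule V_convergent_subsequence[of X "s - \<tau>" "s + h" R]) (use X X0 XR in blast)+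
  \<comment> \<open>\<open>K\<close> times the L1 bound that follows from \<open>R\<close>. It
    bounds all \<open>V (X n)\<close> and their limit at every point, so
    \<open>(2 * B)\<^sup>2\<close> can serve as the dominating constant.\<close>
  define B where "B = K * ((R + measure lborel {s - \<tau>..s + h}) / 2)"
  have Vle: "norm (V (X n) t) \<le> B" for n t
  proof -
    have "(\<integral>u. indicator UNIV u * norm (X n u) \<partial>lborel)
        \<le> (1 * (\<integral>u. (norm (X n u))\<^sup>2 \<partial>lborel) + measure lborel (UNIV \<inter> {s - \<tau>..s + h}) / 1) / 2"
      by (rule norm_set_integral_le_AM_GM[OF X X0]) auto
    then have "(\<integral>u. norm (X n u) \<partial>lborel) \<le> (R + measure lborel {s - \<tau>..s + h}) / 2"
      using XR[of n] by simp
    then have "K * (\<integral>u. norm (X n u) \<partial>lborel) \<le> B"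
      unfolding B_def using K_pos by (intro mult_left_mono) auto
    then show ?thesis
      using V_norm_le[OF integrable_if_L2_compact_support[OF X X0], where t = t] order_trans by blast
  qed
  have VXm [measurable]: "V (X n) \<in> borel_measurable borel" for n
    using X[of n] by (intro V_measurable) (simp add: L2_fun_def)
  define y where "y t = lim (\<lambda>n. V (X (r n)) t)" for t
  have ym [measurable]: "y \<in> borel_measurable borel" unfolding y_def by measurable
  have ylim: "(\<lambda>n. V (X (r n)) t) \<longlonglongrightarrow> y t" for t
    using conv[of t] by (simp add: y_def convergent_LIMSEQ_iff)
  have yle: "norm (y t) \<le> B" for t
    by (rule LIMSEQ_le_const2[OF tendsto_norm[OF ylim[of t]]]) (use Vle in auto)
  have seg_const: "integrable seg_measure (\<lambda>_. c :: real)" for c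
    by (rule finite_measure.integrable_const[OF finite_measure_lebesgue_on]) simp
  have seg_m: "(\<lambda>\<theta>. g (s + h + \<theta>)) \<in> borel_measurable seg_measure"
    if "g \<in> borel_measurable borel" for g :: "real \<Rightarrow> real^'n"
    by (intro measurable_restrict_space1 measurable_completion measurable_compose[OF _ that]) simp
  have seg_L2: "(\<lambda>\<theta>. g (s + h + \<theta>)) \<in> L2_fun seg_measure"
    if "g \<in> borel_measurable borel" "\<And>t. norm (g t) \<le> B" for g :: "real \<Rightarrow> real^'n"
  proof -
    have "integrable seg_measure (\<lambda>\<theta>. (norm (g (s + h + \<theta>)))\<^sup>2)"
    proof (rule Bochner_Integration.integrable_bound)
      show "integrable seg_measure (\<lambda>\<theta>. B\<^sup>2)" by (rule seg_const)
      show "AE \<theta> in seg_measure. norm ((norm (g (s + h + \<theta>)))\<^sup>2) \<le> norm (B\<^sup>2)"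
        using that(2) by (intro AE_I2) (simp add: power_mono)
    qed (use seg_m[OF that(1)] in simp)
    then show ?thesis using seg_m[OF that(1)] by (simp add: L2_fun_def)
  qed
  define l where "l = L2_class seg_measure (\<lambda>\<theta>. y (s + h + \<theta>))"
  have TF: "T (F n) = L2_class seg_measure (\<lambda>\<theta>. V (X n) (s + h + \<theta>))" for n
  proof -
    have "T (F n) = L2_class seg_measure (\<lambda>\<theta>. X n (s + h + \<theta>))"
      using evolution_class_eq[OF L2_rep_fun[OF F] sol, of n] by (simp add: L2_class_rep[OF F])
    \<comment> \<open>Here \<open>\<tau> \<le> h\<close> enters:
      \<open>s + h + \<theta> \<ge> s\<close> on the whole segment.\<close>
    moreover have "AE \<theta> in seg_measure. X n (s + h + \<theta>) = V (X n) (s + h + \<theta>)"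
      using XV[of _ n] tau_le by (intro AE_I2) simp
    ultimately show ?thesis
      using final_segment_L2[OF sol[of n]] seg_L2[OF VXm Vle, of n] by (simp add: L2_class_eq_iff)
  qed
  have "L2_dist seg_measure (T (F n)) l
      = sqrt (\<integral>\<theta>. (norm (V (X n) (s + h + \<theta>) - y (s + h + \<theta>)))\<^sup>2 \<partial>seg_measure)" for n
    unfolding TF l_def by (rule L2_dist_class[OF seg_L2[OF VXm Vle] seg_L2[OF ym yle]])
  moreover have "(\<lambda>n. \<integral>\<theta>. (norm (V (X (r n)) (s + h + \<theta>) - y (s + h + \<theta>)))\<^sup>2 \<partial>seg_measure)
      \<longlonglongrightarrow> (\<integral>\<theta>. 0 \<partial>seg_measure)"
  proof (rule integral_dominated_convergence)
    show "integrable seg_measure (\<lambda>\<theta>. (2 * B)\<^sup>2)" by (rule seg_const)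
    show "AE \<theta> in seg_measure. (\<lambda>n. (norm (V (X (r n)) (s + h + \<theta>) - y (s + h + \<theta>)))\<^sup>2) \<longlonglongrightarrow> 0"
    proof (rule AE_I2)
      fix \<theta>
      have "(\<lambda>n. (norm (V (X (r n)) (s + h + \<theta>) - y (s + h + \<theta>)))\<^sup>2)
          \<longlonglongrightarrow> (norm (y (s + h + \<theta>) - y (s + h + \<theta>)))\<^sup>2"
        by (intro tendsto_intros ylim)
      then show "(\<lambda>n. (norm (V (X (r n)) (s + h + \<theta>) - y (s + h + \<theta>)))\<^sup>2) \<longlonglongrightarrow> 0" by simp
    qed
    show "AE \<theta> in seg_measure.
        norm ((norm (V (X (r n)) (s + h + \<theta>) - y (s + h + \<theta>)))\<^sup>2) \<le> (2 * B)\<^sup>2" for n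
    proof (rule AE_I2)
      fix \<theta>
      have "norm (V (X (r n)) (s + h + \<theta>) - y (s + h + \<theta>)) \<le> 2 * B"
        using norm_triangle_ineq4[of "V (X (r n)) (s + h + \<theta>)" "y (s + h + \<theta>)"]
          Vle[of "r n" "s + h + \<theta>"] yle[of "s + h + \<theta>"] by linarith
      from power_mono[OF this norm_ge_zero, of 2]
      show "norm ((norm (V (X (r n)) (s + h + \<theta>) - y (s + h + \<theta>)))\<^sup>2) \<le> (2 * B)\<^sup>2"
        by simp
    qed
  qed (use seg_m[OF VXm] seg_m[OF ym] in simp_all)
  ultimately have "(\<lambda>n. L2_dist seg_measure (T (F (r n))) l) \<longlonglongrightarrow> sqrt 0"
    by (simp only:) (intro tendsto_real_sqrt, simp)
  then show thesis
    by (intro that[of l r] r) (auto simp: l_def intro: L2_class_in seg_L2 ym yle)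
qed

text \<open>Limits of subsequences are only known to lie in the whole space, not in the image of
  \<open>B\<close>; this is exactly the Bolzano-Weierstrass criterion for compactness of the
  closure.\<close>

lemma evolution_image_relatively_compact:
  assumes B: "Metric_space.mbounded (L2 seg_measure) (L2_dist seg_measure) B"
  shows "compactin (Metric_space.mtopology (L2 seg_measure) (L2_dist seg_measure))
    (Metric_space.mtopology (L2 seg_measure) (L2_dist seg_measure) closure_of (T ` B))"
proof -
  interpret L: Metric_space "L2 seg_measure :: (real \<Rightarrow> real^'n) set set" "L2_dist seg_measure"
    by (rule Metric_space_L2)
  have BL: "B \<subseteq> L2 seg_measure" using B by (simp add: L.mbounded_alt)
  have TB: "T ` B \<subseteq> L2 seg_measure" using BL evolution_in_L2 by blast
  have z: "(\<lambda>_. 0 :: real^'n) \<in> L2_fun seg_measure" by (simp add: L2_fun_def)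
  obtain P where P: "\<And>F. F \<in> B \<Longrightarrow> (\<integral>\<theta>. (norm (L2_rep F \<theta>))\<^sup>2 \<partial>seg_measure) \<le> P"
  proof -
    obtain D c where c: "c \<in> L2 seg_measure" and D: "\<And>F. F \<in> B \<Longrightarrow> L2_dist seg_measure c F \<le> D"
      using B L2_class_in[OF z] by (force simp: L.mbounded)
    let ?z = "L2_class seg_measure (\<lambda>_. 0 :: real^'n)"
    show thesis
    proof (rule that)
      fix F assume F: "F \<in> B"
      then have FL: "F \<in> L2 seg_measure" using BL by blast
      \<comment> \<open>The ball containing \<open>B\<close> has an arbitrary centre
        \<open>c\<close>; recentring it at the zero class turns distance into the L2 norm.\<close>
      have "L2_dist seg_measure ?z F \<le> L2_dist seg_measure ?z c + D"
        using L.triangle[OF L2_class_in[OF z] c FL] D[OF F] by linarith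
      moreover have "L2_dist seg_measure ?z F = sqrt (\<integral>\<theta>. (norm (L2_rep F \<theta>))\<^sup>2 \<partial>seg_measure)"
        using L2_dist_class[OF z L2_rep_fun[OF FL]] by (simp add: L2_class_rep[OF FL])
      ultimately show "(\<integral>\<theta>. (norm (L2_rep F \<theta>))\<^sup>2 \<partial>seg_measure) \<le> (L2_dist seg_measure ?z c + D)\<^sup>2"
        by (simp add: real_le_lsqrt sqrt_le_D)
    qed
  qed
  have "\<exists>l r. l \<in> L2 seg_measure \<and> strict_mono r \<and> limitin L.mtopology (\<sigma> \<circ> r) l sequentially"
    if "range \<sigma> \<subseteq> T ` B" for \<sigma> :: "nat \<Rightarrow> _"
  proof -
    have "\<forall>n. \<exists>F. F \<in> B \<and> \<sigma> n = T F" using that by blast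
    from choice[OF this] obtain F where FB: "\<And>n. F n \<in> B" and \<sigma>: "\<And>n. \<sigma> n = T (F n)" by blast
    obtain l and r :: "nat \<Rightarrow> nat" where l: "l \<in> L2 seg_measure" "strict_mono r"
      "(\<lambda>n. L2_dist seg_measure (T (F (r n))) l) \<longlonglongrightarrow> 0"
      by (rule evolution_bounded_sequence[of F P]) (use FB BL P in blast)+
    moreover have "limitin L.mtopology (\<sigma> \<circ> r) l sequentially"
      using l evolution_in_L2[OF subsetD[OF BL FB]] by (simp add: L.limitin_metric_dist_null \<sigma>)
    ultimately show ?thesis by blast
  qed
  then have "\<forall>S. S \<subseteq> T ` B \<and> infinite S \<longrightarrow> L2 seg_measure \<inter> L.mtopology derived_set_of S \<noteq> {}"
    using L.Bolzano_Weierstrass_property[OF TB TB] by blast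
  then show ?thesis by (auto simp: L.compact_closure_of_eq_Bolzano_Weierstrass)
qed

end

theorem theorem3p1:
  fixes \<tau> s h :: real and C :: "real \<Rightarrow> real \<Rightarrow> real^'n^'n"
  assumes "\<tau> > 0" and "h \<ge> \<tau>"
    and "(\<lambda>(t, \<theta>). C t \<theta>) \<in> Linf_fun (lebesgue_on ({s..s + h} \<times> {-\<tau>..0}))"
  shows "L2_compact_operator (lebesgue_on {-\<tau>..0}) (evolution \<tau> h C (s + h) s)"
proof -
  obtain k K where "renewal_kernel k s h K \<tau> C" by (rule renewal_kernel_exists[OF assms])
  then interpret renewal_kernel k s h K \<tau> C .
  show ?thesis
    unfolding L2_compact_operator_def
    using evolution_in_L2 evolution_add evolution_scale evolution_image_relatively_compact by blast
qed

end
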